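(* Let $f$ be a transcendental entire function. Then $I(f)$ is a spider's web if and only if $I(f)$ separates some point of $J(f)$ from infinity; and $A(f)$ is a spider's web if and only if $A(f)$ separates some point of $J(f)$ from infinity. Moreover, if $f$ has no multiply connected Fatou components, then $J(f)$ is a spider's web if and only if $J(f)$ separates some point of $J(f)$ from infinity.
   Context: $f^n$ denotes the $n$-th iterate of $f$. $J(f)$ is the Julia set (points in no neighbourhood of which $(f^n)$ is normal), $F(f)=\mathbb{C}\setminus J(f)$ the Fatou set, whose components are Fatou components. $I(f) := \{z : f^n(z)\to\infty\}$. The maximum modulus function is $M(r,f)=\max_{|z|=r}|f(z)|$ and $M^n(r,f)$ denotes its $n$-th iterate in the variable $r$; the fast escaping set is $A(f) := \{z\in\mathbb{C} : \exists \ell\in\mathbb{N} \text{ with } |f^{n+\ell}(z)|\ge M^n(R,f) \text{ for all } n\in\mathbb{N}\}$, where $R>0$ is fixed large enough that $M^n(R,f)\to\infty$. A set $E\subset\mathbb{C}$ separates a point $z$ from infinity if there is a bounded open set $U$ with $z\in U$ and $\partial U\subset E$. A connected set $E\subset\mathbb{C}$ is a spider's web if there is a sequence $(G_n)$ of bounded simply connected domains with $\partial G_n\subset E$, $G_n\subset G_{n+1}$, and $\bigcup_n G_n=\mathbb{C}$. *)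

theory Defs
  imports "HOL-Complex_Analysis.Complex_Analysis"
begin

definition transcendental_entire :: "(complex \<Rightarrow> complex) \<Rightarrow> bool" where
  "transcendental_entire f \<longleftrightarrow> f holomorphic_on UNIV \<and> \<not> (\<exists>p. \<forall>z. f z = poly p z)"

definition normal_family :: "(complex \<Rightarrow> complex) set \<Rightarrow> complex set \<Rightarrow> bool" where
  "normal_family F U \<longleftrightarrow>
     (\<forall>s :: nat \<Rightarrow> complex \<Rightarrow> complex. (\<forall>j. s j \<in> F) \<longrightarrow>
        (\<exists>r. strict_mono r \<and>
           ((\<exists>g. \<forall>K. compact K \<and> K \<subseteq> U \<longrightarrow> uniform_limit K (s \<circ> r) g sequentially) \<or>
            (\<forall>K. compact K \<and> K \<subseteq> U \<longrightarrow>
               (\<forall>B. eventually (\<lambda>j. \<forall>z\<in>K. B < norm ((s \<circ> r) j z)) sequentially)))))"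

definition fatou_set :: "(complex \<Rightarrow> complex) \<Rightarrow> complex set" where
  "fatou_set f = {z. \<exists>U. open U \<and> z \<in> U \<and> normal_family (range (\<lambda>n. f ^^ n)) U}"

definition julia_set :: "(complex \<Rightarrow> complex) \<Rightarrow> complex set" where
  "julia_set f = UNIV - fatou_set f"

definition escaping_set :: "(complex \<Rightarrow> complex) \<Rightarrow> complex set" where
  "escaping_set f = {z. filterlim (\<lambda>n. norm ((f ^^ n) z)) at_top sequentially}"

definition max_modulus :: "real \<Rightarrow> (complex \<Rightarrow> complex) \<Rightarrow> real" where
  "max_modulus r f = Sup ((\<lambda>z. norm (f z)) ` sphere 0 r)"

definition fast_escaping_set :: "(complex \<Rightarrow> complex) \<Rightarrow> real \<Rightarrow> complex set" where
  "fast_escaping_set f R = {z. \<exists>l\<ge>1. \<forall>n\<ge>1.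
      norm ((f ^^ (n + l)) z) \<ge> ((\<lambda>r. max_modulus r f) ^^ n) R}"

definition separates_from_infinity :: "complex set \<Rightarrow> complex \<Rightarrow> bool" where
  "separates_from_infinity E z \<longleftrightarrow> (\<exists>U. open U \<and> bounded U \<and> z \<in> U \<and> frontier U \<subseteq> E)"

definition spiders_web :: "complex set \<Rightarrow> bool" where
  "spiders_web E \<longleftrightarrow> connected E \<and>
     (\<exists>G :: nat \<Rightarrow> complex set.
        (\<forall>n. open (G n) \<and> connected (G n) \<and> bounded (G n) \<and> simply_connected (G n) \<and>
             frontier (G n) \<subseteq> E \<and> G n \<subseteq> G (Suc n)) \<and>
        (\<Union>n. G n) = UNIV)"

end

theory Submission
  imports Defs
begin

text \<open>
  Let \<open>E\<close> be one of the three sets. If a bounded domain \<open>U\<close> around a point of the Julia set has its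
  frontier in \<open>E\<close>, then so do its images under the iterates of \<open>f\<close>. By Montel's theorem these
  images contain arbitrarily large circles centred at 0, for otherwise all iterates would omit a point of
  each of two fixed circles. Filling the holes of the images gives the domains of the web.

  A set carrying such domains is connected as soon as no bounded domain \<open>W\<close> meets \<open>E\<close> while its
  frontier avoids \<open>E\<close>. For the fast escaping set this is the maximum principle. For the Julia set it is
  the simple connectivity of the Fatou components. For the escaping set, if \<open>W\<close> meets the Julia set,
  some image of \<open>W\<close> contains a large circle, and a theorem of Bohr type (from Schottky's theorem) shows
  that \<open>f\<^sup>n\<close> is at least the \<open>n\<close>-th iterate of the maximum modulus somewhere on that circle, so
  the maximum principle applies again; if \<open>W\<close> lies in the Fatou set, the web itself
  confines the late images of \<open>W\<close> and forces all of its frontier to escape.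

  Conversely, if the Julia set were empty while some point escapes, every point would escape,
  but \<open>f \<circ> f\<close> has a fixed point.
\<close>

section \<open>Webs in the plane\<close>

text \<open>Filling the holes of \<open>T\<close> turns it into a candidate for a web domain.
  \<open>outside T\<close> is a component of the complement of \<open>T\<close>, so its frontier
  lies in that of \<open>T\<close> and its own complement is connected; the connectedness of
  \<open>outside T\<close> gives simple connectivity.\<close>

lemma fill_bounded_domain:
  fixes T :: "complex set"
  assumes "open T" "connected T" "bounded T"
  shows "open (- outside T)" "connected (- outside T)" "bounded (- outside T)"
    and "simply_connected (- outside T)" "frontier (- outside T) \<subseteq> frontier T"
proof -
  have O: "outside T \<in> components (- T)"
    using bounded_unique_outside[OF \<open>bounded T\<close>, of "outside T"] by simp
  then have "closed (outside T)"
    using closed_components \<open>open T\<close> by blast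
  then show op: "open (- outside T)"
    by blast
  show con: "connected (- outside T)"
    using component_complement_connected[OF \<open>connected T\<close> O] .
  show bo: "bounded (- outside T)"
    by (simp add: assms cobounded_outside)
  have "connected (outside T)"
    using O in_components_connected by blast
  then show "simply_connected (- outside T)"
    using simply_connected_iff_simple[OF op bo] con by simp
  show "frontier (- outside T) \<subseteq> frontier T"
    using frontier_of_components_subset[OF O] by simp
qed

text \<open>A component of the complement of \<open>T\<close> that starts inside the circle cannot
  cross it, hence is bounded. So a domain containing a circle contains the whole disc once its holes
  are filled.\<close>

lemma ball_disjoint_outside:
  fixes T :: "complex set"
  assumes "sphere 0 s \<subseteq> T"
  shows "ball 0 s \<subseteq> - outside T"
proof
  fix x :: complex assume x: "x \<in> ball 0 s"
  let ?C = "connected_component_set (- T) x"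
  have "?C \<subseteq> ball 0 s"
  proof (rule ccontr)
    assume nsub: "\<not> ?C \<subseteq> ball 0 s"
    \<comment> \<open>For \<open>x\<close> in \<open>T\<close> the set \<open>?C\<close> would be
      empty, hence contained in the ball.\<close>
    then have "x \<in> ?C"
      by (metis Collect_empty_eq connected_component_eq_empty connected_component_refl_eq
          empty_subsetI mem_Collect_eq)
    then have "?C \<inter> frontier (ball 0 s) \<noteq> {}"
      using x nsub by (intro connected_Int_frontier connected_connected_component) blast+
    moreover have "?C \<subseteq> - T"
      by (simp add: connected_component_subset)
    moreover have "frontier (ball 0 s) \<subseteq> sphere (0::complex) s"
      using x frontier_ball[of s 0] by (metis dist_0_norm mem_ball norm_ge_zero le_less_trans order_refl)
    ultimately show False
      using assms by blast
  qed
  then have "bounded ?C"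
    using bounded_ball bounded_subset by blast
  then show "x \<in> - outside T"
    by (simp add: outside)
qed

text \<open>The sequence half of \<open>spiders_web\<close>, split off because the connectedness of
  \<open>E\<close> is later derived from it.\<close>

definition web_sequence :: "complex set \<Rightarrow> (nat \<Rightarrow> complex set) \<Rightarrow> bool" where
  "web_sequence E G \<longleftrightarrow>
     (\<forall>n. open (G n) \<and> connected (G n) \<and> bounded (G n) \<and> simply_connected (G n) \<and>
          frontier (G n) \<subseteq> E \<and> G n \<subseteq> G (Suc n)) \<and> (\<Union>n. G n) = UNIV"

lemma spiders_web_iff: "spiders_web E \<longleftrightarrow> connected E \<and> (\<exists>G. web_sequence E G)"
  by (simp add: spiders_web_def web_sequence_def)

lemma web_sequence_mono: "web_sequence E G \<Longrightarrow> m \<le> n \<Longrightarrow> G m \<subseteq> G n"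
  by (rule lift_Suc_mono_le) (auto simp: web_sequence_def)

text \<open>The only form in which simple connectivity of the web domains is used: such a frontier
  cannot be divided between disjoint open sets, nor between a set and its complement without meeting
  the frontier of that set.\<close>

lemma web_sequence_connected_frontier: "web_sequence E G \<Longrightarrow> connected (frontier (G n))"
  using simply_connected_eq_frontier_properties unfolding web_sequence_def by metis

lemma web_sequence_covers_compact:
  assumes "web_sequence E G" "compact K"
  obtains n where "K \<subseteq> G n"
proof -
  have "open (G n)" for n
    using assms(1) by (auto simp: web_sequence_def)
  moreover have "K \<subseteq> (\<Union>n. G n)"
    using assms(1) by (auto simp: web_sequence_def)
  ultimately obtain N where N: "finite N" "K \<subseteq> (\<Union>n\<in>N. G n)"
    by (metis compactE_image[OF assms(2), of UNIV G])
  have "K \<subseteq> G (Max N)"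
    using N(2) web_sequence_mono[OF assms(1) Max_ge[OF N(1)]] by blast
  then show ?thesis ..
qed

lemma web_sequence_exists:
  assumes "\<And>r::real. \<exists>T s. open T \<and> connected T \<and> bounded T \<and> frontier T \<subseteq> E \<and>
             r \<le> s \<and> sphere 0 s \<subseteq> T"
  shows "\<exists>G. web_sequence E G"
proof -
  \<comment> \<open>The ball of radius \<open>n\<close> makes the domains exhaust the plane.\<close>
  define P where "P n S \<longleftrightarrow> open S \<and> connected S \<and> bounded S \<and> simply_connected S \<and>
    frontier S \<subseteq> E \<and> ball (0::complex) (real n) \<subseteq> S" for n S
  have big: "\<exists>S. P n S \<and> ball 0 r \<subseteq> S" for n r
  proof -
    obtain T s where T: "open T" "connected T" "bounded T" "frontier T \<subseteq> E"
      "max r n \<le> s" "sphere 0 s \<subseteq> T"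
      using assms by blast
    have "ball (0::complex) r \<subseteq> ball 0 s" "ball (0::complex) n \<subseteq> ball 0 s"
      using T(5) by auto
    then have "ball 0 r \<subseteq> - outside T" "ball 0 n \<subseteq> - outside T"
      using ball_disjoint_outside[OF T(6)] by (meson order_trans)+
    moreover have "frontier (- outside T) \<subseteq> E"
      using fill_bounded_domain(5)[OF T(1-3)] T(4) by blast
    ultimately show ?thesis
      unfolding P_def using fill_bounded_domain(1-4)[OF T(1-3)] by blast
  qed
  have "\<exists>G. \<forall>n. P n (G n) \<and> G n \<subseteq> G (Suc n)"
  proof (rule dependent_nat_choice)
    show "\<exists>S. P 0 S"
      using big by blast
    show "\<exists>S'. P (Suc n) S' \<and> S \<subseteq> S'" if "P n S" for S n
    proof -
      have "bounded S"
        using that by (simp add: P_def)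
      then obtain r where "S \<subseteq> ball 0 r"
        by (metis bounded_subset_ballD)
      \<comment> \<open>Nesting: the next domain is taken large enough to swallow a ball containing
        the bounded set \<open>S\<close>.\<close>
      then show ?thesis
        using big[of "Suc n" r] by blast
    qed
  qed
  then obtain G where G: "\<forall>n. P n (G n) \<and> G n \<subseteq> G (Suc n)"
    by blast
  have "(\<Union>n. G n) = UNIV"
  proof (intro set_eqI iffI UNIV_I)
    fix x :: complex
    obtain n where n: "norm x < real n"
      using reals_Archimedean2 by blast
    have "ball 0 (real n) \<subseteq> G n"
      using G by (simp add: P_def)
    with n have "x \<in> G n"
      by auto
    then show "x \<in> (\<Union>n. G n)"
      by blast
  qed
  then show ?thesis
    using G unfolding web_sequence_def P_def by (intro exI[of _ G] conjI allI) (auto simp only:)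
qed

text \<open>A set carrying a web can only be disconnected by splitting off a bounded piece, because
  every \<open>frontier (G n)\<close> lies on one side of a separation.\<close>

lemma web_sequence_imp_connected:
  assumes G: "web_sequence E G"
    and meets: "\<And>W. open W \<Longrightarrow> connected W \<Longrightarrow> bounded W \<Longrightarrow> W \<inter> E \<noteq> {} \<Longrightarrow> frontier W \<inter> E \<noteq> {}"
  shows "connected E"
proof (rule ccontr)
  assume "\<not> connected E"
  then obtain A B where AB: "A \<union> B = E" "A \<noteq> {}" "B \<noteq> {}" "separatedin euclidean A B"
    using connectedin_eq_not_separated[of euclidean E] by auto
  obtain U V where UV: "open U" "open V" "A \<subseteq> U" "B \<subseteq> V" "U \<inter> V = {}"
    using metrizable_space_separation[OF metrizable_space_euclidean AB(4)]
    by (auto simp: disjnt_def)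
  \<comment> \<open>Stated for a generic ordered pair of sides, as either one may be the side
    containing arbitrarily late frontiers.\<close>
  have no: False
    if H: "open U" "open V" "U \<inter> V = {}" "E \<subseteq> U \<union> V" "E \<inter> V \<noteq> {}"
      and inf: "\<And>m. \<exists>n\<ge>m. frontier (G n) \<subseteq> U" for U V
  proof -
    obtain z where z: "z \<in> E" "z \<in> V"
      using H by blast
    obtain m where "z \<in> G m"
      using G unfolding web_sequence_def by blast
    then obtain n where n: "z \<in> G n" "frontier (G n) \<subseteq> U"
      using inf web_sequence_mono[OF G] by blast
    \<comment> \<open>A frontier point of \<open>W\<close> in \<open>E\<close> cannot lie in
      \<open>U\<close>, which misses \<open>closure V\<close>; so it lies in \<open>V\<close>, hence
      off \<open>frontier V\<close>, hence on \<open>frontier (G n)\<close>, which is inside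
      \<open>U\<close>.\<close>
    define W where "W = connected_component_set (G n \<inter> V) z"
    have Gn: "open (G n)" "bounded (G n)"
      using G unfolding web_sequence_def by blast+
    have "open W" "connected W" "z \<in> W"
      unfolding W_def using Gn H n z by (auto simp: open_connected_component open_Int)
    moreover have "bounded W"
      unfolding W_def using Gn(2) by (meson bounded_Int bounded_subset connected_component_subset)
    ultimately obtain e where e: "e \<in> frontier W" "e \<in> E"
      using meets z by blast
    have "e \<in> frontier (G n \<inter> V)"
      using e frontier_of_connected_component_subset W_def by blast
    then have e': "e \<in> closure V" "e \<in> frontier (G n) \<union> frontier V"
      using closure_mono[of "G n \<inter> V" V] by (auto simp: frontier_Int)
    have "closure V \<inter> U = {}"
      using H(1,3) open_Int_closure_eq_empty by blast
    then have "e \<in> V"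
      using e e' H(4) by blast
    moreover have "frontier V \<inter> V = {}"
      using H(2) frontier_disjoint_eq by blast
    ultimately show False
      using e' n(2) \<open>U \<inter> V = {}\<close> by blast
  qed
  have side: "frontier (G n) \<subseteq> U \<or> frontier (G n) \<subseteq> V" for n
  proof -
    have "frontier (G n) \<subseteq> U \<union> V"
      using G AB(1) UV unfolding web_sequence_def by blast
    then show ?thesis
      using connectedD[OF web_sequence_connected_frontier[OF G, of n] UV(1,2)] UV(5) by blast
  qed
  consider "\<And>m. \<exists>n\<ge>m. frontier (G n) \<subseteq> U" | "\<And>m. \<exists>n\<ge>m. frontier (G n) \<subseteq> V"
    using side by (metis nle_le)
  then show False
  proof cases
    case 1
    then show False using no[of U V] UV AB by blast
  next
    case 2
    then show False using no[of V U] UV AB by blast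
  qed
qed

section \<open>Normality and omitted values\<close>

text \<open>Montel's theorem asks for a bound on the whole sequence, while convergence controls only
  a tail; the finitely many remaining members are bounded by compactness.\<close>

lemma family_bounded_if_eventually_bounded:
  fixes F :: "nat \<Rightarrow> complex \<Rightarrow> complex"
  assumes "compact K" "\<And>n. continuous_on K (F n)"
    and ev: "\<forall>\<^sub>F n in sequentially. \<forall>z\<in>K. norm (F n z) \<le> B"
  shows "\<exists>B. \<forall>n. \<forall>z\<in>K. norm (F n z) \<le> B"
proof -
  have "\<exists>b. \<forall>z\<in>K. norm (F n z) \<le> b" for n
    using compact_imp_bounded[OF compact_continuous_image[OF assms(2,1)], of n]
    by (auto simp: bounded_iff)
  then obtain b where b: "\<And>n z. z \<in> K \<Longrightarrow> norm (F n z) \<le> b n"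
    by metis
  obtain N where N: "\<And>n z. n \<ge> N \<Longrightarrow> z \<in> K \<Longrightarrow> norm (F n z) \<le> B"
    using ev by (auto simp: eventually_sequentially)
  have "norm (F n z) \<le> \<bar>B\<bar> + (\<Sum>k<N. \<bar>b k\<bar>)" if "z \<in> K" for n z
  proof (cases "n < N")
    case True
    then have "\<bar>b n\<bar> \<le> (\<Sum>k<N. \<bar>b k\<bar>)"
      by (intro member_le_sum) auto
    then show ?thesis
      using b[OF that, of n] by linarith
  next
    case False
    then have "norm (F n z) \<le> B"
      using N that by simp
    moreover have "0 \<le> (\<Sum>k<N. \<bar>b k\<bar>)"
      by (simp add: sum_nonneg)
    ultimately show ?thesis
      by linarith
  qed
  then show ?thesis
    by blast
qed

text \<open>The omitted values may vary with \<open>n\<close>, but being confined to two circles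
  they stay bounded and uniformly apart. Affine maps with uniformly controlled coefficients thus
  reduce the claim to the omitted values 0 and 1. The conclusion has the shape of
  \<open>normal_family\<close>, divergence to infinity included.\<close>

lemma Montel_omitting_circle_points:
  fixes F :: "nat \<Rightarrow> complex \<Rightarrow> complex"
  assumes S: "open S" "connected S"
    and hol: "\<And>n. F n holomorphic_on S"
    and s: "0 < s" and a: "\<And>n. norm (a n) = s" "\<And>n. a n \<notin> F n ` S"
    and b: "\<And>n. norm (b n) = 2 * s" "\<And>n. b n \<notin> F n ` S"
  shows "\<exists>r. strict_mono r \<and>
           ((\<exists>g. \<forall>K. compact K \<and> K \<subseteq> S \<longrightarrow> uniform_limit K (F \<circ> r) g sequentially) \<or>
            (\<forall>K. compact K \<and> K \<subseteq> S \<longrightarrow>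
               (\<forall>B. eventually (\<lambda>j. \<forall>z\<in>K. B < norm ((F \<circ> r) j z)) sequentially)))"
proof (cases "S = {}")
  case True
  then show ?thesis
    by (intro exI[of _ id]) (auto simp: strict_mono_def uniform_limit_iff)
next
  case False
  then obtain w where w: "w \<in> S"
    by blast
  have finite_limit: ?thesis
    if r: "strict_mono r" and bd: "\<And>K. compact K \<Longrightarrow> K \<subseteq> S \<Longrightarrow> \<exists>B. \<forall>n. \<forall>z\<in>K. norm (F (r n) z) \<le> B" for r :: "nat \<Rightarrow> nat"
  proof -
    obtain g k where "strict_mono (k :: nat \<Rightarrow> nat)"
      "\<And>K. \<lbrakk>compact K; K \<subseteq> S\<rbrakk> \<Longrightarrow> uniform_limit K ((F \<circ> r) \<circ> k) g sequentially"
      using Montel[of S "range (F \<circ> r)" "F \<circ> r"] S(1) hol bd by (auto simp: image_iff) metis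
    then show ?thesis
      using r by (intro exI[of _ "r \<circ> k"] conjI disjI1 exI[of _ g]) (auto simp: strict_mono_o o_assoc)
  qed
  define q where "q n z = (F n z - a n) / (b n - a n)" for n z
  have ba: "s \<le> norm (b n - a n)" "norm (b n - a n) \<le> 3 * s" "b n - a n \<noteq> 0" for n
  proof -
    show "s \<le> norm (b n - a n)"
      using norm_triangle_ineq2[of "b n" "a n"] a b by simp
    then show "b n - a n \<noteq> 0"
      using s by auto
    show "norm (b n - a n) \<le> 3 * s"
      using norm_triangle_ineq4[of "b n" "a n"] a b by simp
  qed
  have F_eq: "F n z = a n + (b n - a n) * q n z" for n z
    using ba(3)[of n] by (simp add: q_def)
  have q_hol: "q n holomorphic_on S" for n
    unfolding q_def using ba(3) by (intro holomorphic_intros hol) auto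
  have q01: "q n z \<noteq> 0 \<and> q n z \<noteq> 1" if "z \<in> S" for n z
    using a(2)[of n] b(2)[of n] ba(3)[of n] that by (auto simp: q_def image_iff)
  have F_le: "norm (F n z) \<le> s + 3 * s * B" if "norm (q n z) \<le> B" for n z B
  proof -
    have "norm (F n z) \<le> norm (a n) + norm (b n - a n) * norm (q n z)"
      unfolding F_eq[of n z] by (metis norm_triangle_ineq norm_mult)
    also have "\<dots> \<le> s + (3 * s) * B"
      using ba(2)[of n] that s a(1) by (intro add_mono mult_mono) auto
    finally show ?thesis .
  qed
  \<comment> \<open>Along some subsequence either \<open>q\<close> or its reciprocal is bounded by 1
    at \<open>w\<close>. In the first case the bound spreads to all compact subsets of the connected
    set \<open>S\<close>.\<close>
  have "UNIV = {n. norm (q n w) \<le> 1} \<union> {n. norm (q n w) \<ge> 1}"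
    by auto
  then have "infinite {n. norm (q n w) \<le> 1} \<or> infinite {n. norm (q n w) \<ge> 1}"
    by (metis finite_UnI infinite_UNIV_nat)
  then show ?thesis
  proof
    assume "infinite {n. norm (q n w) \<le> 1}"
    then obtain r :: "nat \<Rightarrow> nat" where r: "strict_mono r" "\<And>n. norm (q (r n) w) \<le> 1"
      using infinite_enumerate by blast
    show ?thesis
    proof (rule finite_limit[OF r(1)])
      fix K assume K: "compact K" "K \<subseteq> S"
      obtain B where "\<And>h z. \<lbrakk>h \<in> range (q \<circ> r); z \<in> K\<rbrakk> \<Longrightarrow> norm (h z) \<le> B"
        by (rule GPicard3[OF S w order_refl, of "range (q \<circ> r)" K]) (use q_hol q01 r(2) K in auto)
      then have "norm (q (r n) z) \<le> B" if "z \<in> K" for n z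
        using that by auto
      then show "\<exists>B. \<forall>n. \<forall>z\<in>K. norm (F (r n) z) \<le> B"
        using F_le by blast
    qed
  next
    assume "infinite {n. norm (q n w) \<ge> 1}"
    then obtain r :: "nat \<Rightarrow> nat" where r: "strict_mono r" "\<And>n. norm (q (r n) w) \<ge> 1"
      using infinite_enumerate by blast
    \<comment> \<open>The reciprocals omit 0 and 1 as well, so the same bound applies to
      them.\<close>
    define p where "p n z = inverse (q (r n) z)" for n z
    have p_hol: "p n holomorphic_on S" for n
      unfolding p_def using q01 q_hol by (intro holomorphic_intros) auto
    have p01: "p n z \<noteq> 0 \<and> p n z \<noteq> 1" if "z \<in> S" for n z
      unfolding p_def using q01[OF that] by simp
    have pw: "norm (p n w) \<le> 1" for n
      unfolding p_def norm_inverse using r(2)[of n] by (simp add: inverse_le_1_iff)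
    have p_bd: "\<exists>B. \<forall>h\<in>range p. \<forall>z\<in>K. norm (h z) \<le> B" if K: "compact K" "K \<subseteq> S" for K
    proof -
      obtain B where "\<And>h z. \<lbrakk>h \<in> range p; z \<in> K\<rbrakk> \<Longrightarrow> norm (h z) \<le> B"
        by (rule GPicard3[OF S w order_refl, of "range p" K]) (use p_hol p01 pw K in auto)
      then show ?thesis by blast
    qed
    obtain g k where g: "g holomorphic_on S" and k: "strict_mono (k :: nat \<Rightarrow> nat)"
      and lim: "\<And>K. \<lbrakk>compact K; K \<subseteq> S\<rbrakk> \<Longrightarrow> uniform_limit K (p \<circ> k) g sequentially"
      by (rule Montel[of S "range p" p]) (use S(1) p_hol p_bd in auto)
    have rk: "strict_mono (r \<circ> k)"
      using r(1) k by (rule strict_mono_o)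
    \<comment> \<open>By Hurwitz a limit of zero-free functions is identically zero or zero-free.
      The first means that \<open>F\<close> tends to infinity, the second that \<open>F\<close> is
      bounded on compact sets.\<close>
    consider "\<And>z. z \<in> S \<Longrightarrow> g z = 0" | "\<And>z. z \<in> S \<Longrightarrow> g z \<noteq> 0"
    proof (cases "g constant_on S")
      case True
      then show ?thesis
        using that unfolding constant_on_def by metis
    next
      case False
      have "g z \<noteq> 0" if "z \<in> S" for z
        by (rule Hurwitz_no_zeros[OF S _ g lim False _ that]) (use p_hol p01 in auto)
      then show ?thesis
        using that by blast
    qed
    then show ?thesis
    proof cases
      case 1
      have "\<forall>\<^sub>F j in sequentially. \<forall>z\<in>K. B < norm ((F \<circ> (r \<circ> k)) j z)"
        if K: "compact K" "K \<subseteq> S" for K B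
      proof -
        \<comment> \<open>Here \<open>s * C\<close> is |B| + 2s. The value \<open>norm q > C\<close>
          then forces \<open>norm (F n z)\<close> above |B|, since the term \<open>a n\<close> costs
          only \<open>s\<close>.\<close>
        define C where "C = (\<bar>B\<bar> + s) / s + 1"
        have C: "C > 0" "s * C > \<bar>B\<bar> + s"
          using s by (auto simp: C_def field_simps intro: add_pos_pos)
        have "\<forall>\<^sub>F j in sequentially. \<forall>z\<in>K. dist ((p \<circ> k) j z) (g z) < inverse C"
          using lim[OF K] C by (simp add: uniform_limit_iff)
        then show ?thesis
        proof eventually_elim
          case (elim j)
          show ?case
          proof
            fix z assume z: "z \<in> K"
            then have zS: "z \<in> S" using K by blast
            let ?q = "q (r (k j)) z"
            have "norm (inverse ?q) < inverse C"
              using bspec[OF elim z] 1[OF zS] by (simp add: p_def)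
            then have "C < norm ?q"
              using C(1) q01[OF zS] by (simp add: norm_inverse)
            then have "\<bar>B\<bar> + s < s * norm ?q"
              using C(2) s by (meson less_trans mult_strict_left_mono)
            also have "\<dots> \<le> norm (b (r (k j)) - a (r (k j))) * norm ?q"
              using ba(1) by (intro mult_right_mono) auto
            also have "\<dots> \<le> norm (F (r (k j)) z) + norm (a (r (k j)))"
              unfolding F_eq[of "r (k j)" z] norm_mult[symmetric]
              by (metis add.commute norm_diff_ineq add_diff_cancel_left' norm_triangle_ineq4)
            finally show "B < norm ((F \<circ> (r \<circ> k)) j z)"
              using a(1) by simp
          qed
        qed
      qed
      then show ?thesis
        using rk by blast
    next
      case 2
      show ?thesis
      proof (rule finite_limit[OF rk])
        fix K assume K: "compact K" "K \<subseteq> S"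
        show "\<exists>B. \<forall>n. \<forall>z\<in>K. norm (F ((r \<circ> k) n) z) \<le> B"
        proof (cases "K = {}")
          case False
          have contg: "continuous_on K (\<lambda>z. norm (g z))"
            using g K(2) by (intro continuous_on_norm)
              (meson holomorphic_on_imp_continuous_on continuous_on_subset)
          obtain z0 where z0: "z0 \<in> K" "\<And>z. z \<in> K \<Longrightarrow> norm (g z0) \<le> norm (g z)"
            using continuous_attains_inf[OF K(1) False contg] by blast
          \<comment> \<open>Half the minimum of |g| on \<open>K\<close>: once \<open>p\<close> is
            within \<open>d\<close> of \<open>g\<close>, it has modulus above \<open>d\<close>, so
            its reciprocal \<open>q\<close> is bounded by 1/d.\<close>
          define d where "d = norm (g z0) / 2"
          have d: "d > 0"
            using 2 z0(1) K(2) by (auto simp: d_def)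
          have "\<forall>\<^sub>F j in sequentially. \<forall>z\<in>K. dist ((p \<circ> k) j z) (g z) < d"
            using lim[OF K] d by (simp add: uniform_limit_iff)
          then have "\<forall>\<^sub>F j in sequentially. \<forall>z\<in>K. norm (F ((r \<circ> k) j) z) \<le> s + 3 * s * inverse d"
          proof eventually_elim
            case (elim j)
            show ?case
            proof
              fix z assume z: "z \<in> K"
              then have zS: "z \<in> S" using K by blast
              let ?q = "q (r (k j)) z"
              have "dist (inverse ?q) (g z) < d"
                using elim z by (simp add: p_def)
              moreover have "2 * d \<le> norm (g z)"
                using z0(2)[OF z] by (simp add: d_def)
              ultimately have "d < norm (inverse ?q)"
                by (smt (verit, best) dist_norm norm_triangle_ineq2 norm_minus_commute)
              then have "norm ?q \<le> inverse d"
                using d q01[OF zS] by (simp add: norm_inverse)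
                  (metis inverse_inverse_eq inverse_less_imp_less less_imp_le zero_less_norm_iff inverse_positive_iff_positive less_imp_inverse_less)
              then show "norm (F ((r \<circ> k) j) z) \<le> s + 3 * s * inverse d"
                using F_le by simp
            qed
          qed
          then show ?thesis
            using hol K by (intro family_bounded_if_eventually_bounded)
              (auto intro: holomorphic_on_imp_continuous_on holomorphic_on_subset)
        qed auto
      qed
    qed
  qed
qed

section \<open>Bohr's theorem and growth of the maximum modulus\<close>

text \<open>The bound of Schottky's theorem for \<open>norm (f 0) \<le> 2\<close> and \<open>norm z \<le> 1/2\<close>, transported
  from the omitted values 0 and 1 to points of the circles of radius \<open>s\<close> and \<open>2 * s\<close>.\<close>

definition schottky_const :: real where
  "schottky_const = 1 + 3 * exp (pi * exp (pi * 18))"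

lemma schottky_const_pos: "schottky_const > 0"
  unfolding schottky_const_def by (intro add_pos_pos mult_pos_pos) auto

text \<open>If a point of each circle were omitted, Schottky's theorem would bound \<open>f\<close>
  on the disc of half the radius by \<open>schottky_const * s\<close>, against the value at
  \<open>z\<close>.\<close>

lemma Bohr_circle:
  assumes hol: "f holomorphic_on cball 0 r" and "0 < r" "0 < s" and f0: "norm (f 0) \<le> s"
    and z: "norm z \<le> r / 2" "schottky_const * s < norm (f z)"
  shows "sphere 0 s \<subseteq> f ` cball 0 r \<or> sphere 0 (2 * s) \<subseteq> f ` cball 0 r"
proof (rule ccontr)
  assume "\<not> ?thesis"
  then obtain a b where a: "norm a = s" "a \<notin> f ` cball 0 r"
    and b: "norm b = 2 * s" "b \<notin> f ` cball 0 r"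
    by (auto simp: subset_iff)
  have ba: "s \<le> norm (b - a)" "norm (b - a) \<le> 3 * s"
    using norm_triangle_ineq2[of b a] norm_triangle_ineq4[of b a] a b by simp_all
  then have ba0: "b - a \<noteq> 0"
    using \<open>0 < s\<close> by auto
  have scale: "of_real r * u \<in> cball 0 r" if "u \<in> cball 0 1" for u :: complex
    using that \<open>0 < r\<close> by (simp add: norm_mult mult_left_le)
  define h where "h u = (f (of_real r * u) - a) / (b - a)" for u
  have hol_h: "h holomorphic_on cball 0 1"
  proof -
    have "(f \<circ> (\<lambda>u. of_real r * u)) holomorphic_on cball 0 1"
      by (intro holomorphic_on_compose holomorphic_intros holomorphic_on_subset[OF hol])
        (use scale in auto)
    then show ?thesis
      unfolding h_def o_def using ba0 by (intro holomorphic_intros) auto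
  qed
  \<comment> \<open>The numerator is at most 2s and the denominator at least s.\<close>
  have h0: "norm (h 0) \<le> 2"
  proof -
    have "norm (f 0 - a) \<le> 2 * s"
      using norm_triangle_ineq4[of "f 0" a] f0 a by simp
    also have "\<dots> \<le> 2 * norm (b - a)"
      using ba by simp
    finally show ?thesis
      using ba0 by (simp add: h_def norm_divide divide_le_eq)
  qed
  have h01: "\<not> (h u = 0 \<or> h u = 1)" if "u \<in> cball 0 1" for u
    using scale[OF that] a(2) b(2) ba0 by (auto simp: h_def image_iff)
  define u where "u = z / of_real r"
  have u: "norm u \<le> 1/2" "of_real r * u = z"
    using z(1) \<open>0 < r\<close> by (auto simp: u_def norm_divide field_simps)
  \<comment> \<open>Schottky's bound with parameters 2 and 1/2; the exponent 2 + 4 + 12 is the 18 in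
    \<open>schottky_const\<close>.\<close>
  have "norm (h u) \<le> exp (pi * exp (pi * (2 + 2 * 2 + 12 * (1/2) / (1 - 1/2))))"
    by (rule Schottky[OF hol_h h0 h01]) (use u in auto)
  then have hu: "norm (h u) \<le> exp (pi * exp (pi * 18))"
    by simp
  have "f z = a + (b - a) * h u"
    using ba0 u by (simp add: h_def)
  then have "norm (f z) \<le> norm a + norm (b - a) * norm (h u)"
    by (metis norm_mult norm_triangle_ineq)
  also have "\<dots> \<le> s + (3 * s) * exp (pi * exp (pi * 18))"
    using ba(2) hu a(1) \<open>0 < s\<close> by (intro add_mono mult_mono) auto
  also have "\<dots> = schottky_const * s"
    by (simp add: schottky_const_def algebra_simps)
  finally show False
    using z(2) by simp
qed

section \<open>The maximum modulus: maximum principle, Taylor coefficients and growth\<close>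

lemma norm_le_max_modulus:
  assumes "f holomorphic_on UNIV" "norm z \<le> r"
  shows "norm (f z) \<le> max_modulus r f"
proof -
  have cont: "continuous_on S (\<lambda>z. norm (f z))" for S
    using assms(1) by (intro continuous_on_norm)
      (meson holomorphic_on_imp_continuous_on continuous_on_subset subset_UNIV)
  have bdd: "bdd_above ((\<lambda>z. norm (f z)) ` sphere 0 r)"
    by (intro bounded_imp_bdd_above compact_imp_bounded compact_continuous_image cont compact_sphere)
  have "norm (f w) \<le> max_modulus r f" if "norm w = r" for w
    unfolding max_modulus_def using that by (intro cSup_upper bdd) auto
  moreover have "frontier (cball (0::complex) r) \<subseteq> sphere 0 r"
    using assms(2) by (cases "r = 0") (auto simp: frontier_def)
  ultimately have le: "norm (f w) \<le> max_modulus r f" if "w \<in> frontier (cball 0 r)" for w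
    using that by auto
  show ?thesis
  proof (rule maximum_modulus_frontier[OF _ _ bounded_cball le])
    show "f holomorphic_on interior (cball 0 r)"
      using assms(1) holomorphic_on_subset by blast
    show "continuous_on (closure (cball 0 r)) f"
      using assms(1) by (meson holomorphic_on_imp_continuous_on continuous_on_subset subset_UNIV)
    show "z \<in> cball 0 r"
      using assms(2) by simp
  qed
qed

lemma max_modulus_attained:
  assumes "f holomorphic_on UNIV" "0 \<le> r"
  obtains z where "norm z = r" "norm (f z) = max_modulus r f"
proof -
  have "continuous_on (sphere 0 r) (\<lambda>z. norm (f z))"
    using assms(1) by (intro continuous_on_norm)
      (meson holomorphic_on_imp_continuous_on continuous_on_subset subset_UNIV)
  then obtain z where z: "z \<in> sphere 0 r" "\<forall>w\<in>sphere 0 r. norm (f w) \<le> norm (f z)"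
    using continuous_attains_sup[of "sphere 0 r" "\<lambda>z. norm (f z)"] assms(2) by auto
  then have "max_modulus r f = norm (f z)"
    unfolding max_modulus_def by (intro cSup_eq_maximum) auto
  then show ?thesis
    using z that by simp
qed

lemma max_modulus_nonneg: "f holomorphic_on UNIV \<Longrightarrow> 0 \<le> r \<Longrightarrow> 0 \<le> max_modulus r f"
  by (metis max_modulus_attained norm_ge_zero)

lemma max_modulus_mono:
  assumes "f holomorphic_on UNIV" "0 \<le> r" "r \<le> r'"
  shows "max_modulus r f \<le> max_modulus r' f"
  using assms by (metis max_modulus_attained norm_le_max_modulus)

lemma transcendental_entire_not_constant:
  "transcendental_entire f \<Longrightarrow> \<not> f constant_on UNIV"
  unfolding transcendental_entire_def constant_on_def by (metis poly_pCons poly_0 mult_zero_right add_0_right UNIV_I)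

lemma open_image_transcendental_entire:
  assumes "transcendental_entire f" "open U"
  shows "open (f ` U)"
  using assms transcendental_entire_not_constant[OF assms(1)]
  by (intro open_mapping_thm[of f UNIV]) (auto simp: transcendental_entire_def)

text \<open>By the open mapping theorem the image of the open disc lies in the interior of the
  closed disc that contains it. Strictness makes the contrapositive usable: a value of modulus at
  least M(r) can only be taken at modulus at least r.\<close>

lemma norm_less_max_modulus:
  assumes "transcendental_entire f" "norm z < r"
  shows "norm (f z) < max_modulus r f"
proof -
  have "f ` ball 0 r \<subseteq> cball 0 (max_modulus r f)"
    using assms norm_le_max_modulus[of f _ r] by (force simp: transcendental_entire_def)
  then have "f ` ball 0 r \<subseteq> ball 0 (max_modulus r f)"
    by (metis interior_maximal interior_cball open_ball open_image_transcendental_entire[OF assms(1)])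
  then show ?thesis
    using assms(2) by (simp add: image_subset_iff)
qed

lemma transcendental_entire_infinitely_many_coeffs:
  assumes "transcendental_entire f"
  obtains j where "j \<ge> N" "(deriv ^^ j) f 0 \<noteq> 0"
proof -
  have False if zero: "\<And>j. j \<ge> N \<Longrightarrow> (deriv ^^ j) f 0 = 0"
  proof -
    define p where "p = (\<Sum>k<N. monom ((deriv ^^ k) f 0 / fact k) k)"
    have "f z = poly p z" for z
    proof -
      have "(\<lambda>n. (deriv ^^ n) f 0 / fact n * (z - 0) ^ n) sums f z"
        using assms by (intro holomorphic_power_series[of f 0 "norm z + 1"])
          (auto simp: transcendental_entire_def intro: holomorphic_on_subset)
      moreover have "(\<lambda>n. (deriv ^^ n) f 0 / fact n * (z - 0) ^ n) sums
          (\<Sum>n<N. (deriv ^^ n) f 0 / fact n * (z - 0) ^ n)"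
        using zero by (intro sums_finite) auto
      ultimately have "f z = (\<Sum>n<N. (deriv ^^ n) f 0 / fact n * (z - 0) ^ n)"
        by (rule sums_unique2)
      then show ?thesis
        by (simp add: p_def poly_sum poly_monom)
    qed
    then show False
      using assms unfolding transcendental_entire_def by blast
  qed
  then show ?thesis
    using that by blast
qed

lemma coeff_le_max_modulus:
  assumes "f holomorphic_on UNIV" "0 < r"
  shows "norm ((deriv ^^ k) f 0 / fact k) * r ^ k \<le> max_modulus r f"
proof -
  have "norm ((deriv ^^ k) f 0) \<le> fact k * max_modulus r f / r ^ k"
    using assms
    by (intro Cauchy_inequality) (auto intro: holomorphic_on_subset norm_le_max_modulus
        holomorphic_on_imp_continuous_on[OF holomorphic_on_subset])
  then show ?thesis
    using assms(2) by (simp add: norm_divide field_simps)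
qed

text \<open>The Taylor series is split at degree \<open>N\<close>. By Cauchy's estimates at radius
  2X the tail is at most 2 M(2X) / 2^N, while the head has order X^N and is beaten by a single
  nonzero coefficient of higher degree.\<close>

lemma max_modulus_doubling:
  assumes f: "transcendental_entire f"
  shows "\<exists>X0. \<forall>X\<ge>X0. C * max_modulus X f \<le> max_modulus (2 * X) f"
proof -
  have hol: "f holomorphic_on UNIV"
    using f by (simp add: transcendental_entire_def)
  \<comment> \<open>The final estimate is M(X)/2 at most 2 M(2X) / 2^N, hence the factor 4.\<close>
  obtain N :: nat where N: "4 * C \<le> 2 ^ N"
    using real_arch_pow[of 2 "4 * C"] by (auto intro: less_imp_le)
  define a where "a k = (deriv ^^ k) f 0 / fact k" for k
  obtain j where j: "j \<ge> Suc N" "a j \<noteq> 0"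
    using transcendental_entire_infinitely_many_coeffs[OF f, of "Suc N"] by (auto simp: a_def)
  define A where "A = (\<Sum>k<N. norm (a k))"
  have A0: "A \<ge> 0"
    by (simp add: A_def sum_nonneg)
  \<comment> \<open>The second threshold makes the head at most half of M(X).\<close>
  have "C * max_modulus X f \<le> max_modulus (2 * X) f" if X: "X \<ge> max 1 (2 * A / norm (a j))" for X
  proof -
    have X1: "X \<ge> 1" and XA: "2 * A \<le> norm (a j) * X"
      using X j(2) by (auto simp: divide_le_eq mult.commute)
    obtain z where z: "norm z = X" "norm (f z) = max_modulus X f"
      using max_modulus_attained[OF hol, of X] X1 by auto
    define M2 where "M2 = max_modulus (2 * X) f"
    have sums: "(\<lambda>k. a k * z ^ k) sums f z"
      using holomorphic_power_series[of f 0 "norm z + 1" z] hol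
      by (auto simp: a_def intro: holomorphic_on_subset)
    then have tail: "(\<lambda>k. a (k + N) * z ^ (k + N)) sums (f z - (\<Sum>k<N. a k * z ^ k))"
      by (rule sums_split_initial_segment)
    have coeff_le: "norm (a (k + N) * z ^ (k + N)) \<le> M2 / 2 ^ N * (1/2) ^ k" for k
    proof -
      have "norm (a (k + N)) * (2 * X) ^ (k + N) \<le> M2"
        unfolding a_def M2_def using X1 by (intro coeff_le_max_modulus hol) auto
      then show ?thesis
        using z(1) by (simp add: norm_mult norm_power power_mult_distrib power_add field_simps)
    qed
    have geo: "(\<lambda>k. M2 / 2 ^ N * (1/2) ^ k) sums (M2 / 2 ^ N * 2)"
      using sums_mult[OF geometric_sums[of "1/2::real"], of "M2 / 2 ^ N"] by simp
    have "norm (f z - (\<Sum>k<N. a k * z ^ k)) \<le> M2 / 2 ^ N * 2"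
      using norm_suminf_le[of "\<lambda>k. a (k + N) * z ^ (k + N)" "\<lambda>k. M2 / 2 ^ N * (1/2) ^ k"]
        coeff_le tail geo by (simp add: sums_iff)
    moreover have "norm (\<Sum>k<N. a k * z ^ k) \<le> A * X ^ N"
    proof -
      have "norm (\<Sum>k<N. a k * z ^ k) \<le> (\<Sum>k<N. norm (a k) * X ^ N)"
        using X1 z(1) by (intro sum_norm_le)
          (auto simp: norm_mult norm_power intro!: mult_left_mono power_increasing)
      then show ?thesis
        by (simp add: A_def sum_distrib_right)
    qed
    moreover have "2 * (A * X ^ N) \<le> max_modulus X f"
    proof -
      have "2 * A * X ^ N \<le> norm (a j) * X * X ^ N"
        using XA X1 by (intro mult_right_mono) auto
      also have "\<dots> \<le> norm (a j) * X ^ j"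
        using X1 j(1) power_increasing[of "Suc N" j X] by (simp add: mult.assoc mult_left_mono)
      also have "\<dots> \<le> max_modulus X f"
        unfolding a_def using X1 by (intro coeff_le_max_modulus hol) auto
      finally show ?thesis by simp
    qed
    ultimately have "max_modulus X f / 2 \<le> M2 / 2 ^ N * 2"
      using norm_triangle_ineq2[of "f z" "\<Sum>k<N. a k * z ^ k"] z(2) by linarith
    then have "2 ^ N * max_modulus X f \<le> 4 * M2"
      by (simp add: field_simps)
    moreover have "4 * C * max_modulus X f \<le> 2 ^ N * max_modulus X f"
      using N X1 max_modulus_nonneg[OF hol, of X] by (intro mult_right_mono) auto
    ultimately show ?thesis
      by (simp add: M2_def)
  qed
  then show ?thesis
    by blast
qed

text \<open>One nonzero Taylor coefficient of degree at least 2 suffices. The form X + 1 gives each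
  iterate of M a definite gain.\<close>

lemma max_modulus_superlinear:
  assumes f: "transcendental_entire f"
  shows "\<exists>X0. \<forall>X\<ge>X0. X + 1 \<le> max_modulus X f"
proof -
  have hol: "f holomorphic_on UNIV"
    using f by (simp add: transcendental_entire_def)
  obtain j where j: "j \<ge> 2" "(deriv ^^ j) f 0 \<noteq> 0"
    using transcendental_entire_infinitely_many_coeffs[OF f] by metis
  define a where "a = norm ((deriv ^^ j) f 0 / fact j)"
  have a: "a > 0"
    using j by (simp add: a_def)
  have "X + 1 \<le> max_modulus X f" if X: "X \<ge> max 1 (2 / a)" for X
  proof -
    have X1: "X \<ge> 1" and "2 \<le> a * X"
      using X a by (auto simp: divide_le_eq mult.commute)
    then have "2 * X \<le> (a * X) * X"
      by (intro mult_right_mono) auto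
    also have "\<dots> = a * X ^ 2"
      by (simp add: power2_eq_square)
    also have "\<dots> \<le> a * X ^ j"
      using X1 j a by (intro mult_left_mono power_increasing) auto
    also have "\<dots> \<le> max_modulus X f"
      unfolding a_def using X1 by (intro coeff_le_max_modulus hol) auto
    finally show ?thesis
      using X1 by simp
  qed
  then show ?thesis
    by blast
qed

text \<open>Bohr's theorem loses a constant factor in the radius at each step; the doubling property
  of the maximum modulus wins it back.\<close>

lemma image_contains_large_circle:
  assumes f: "transcendental_entire f"
  shows "\<exists>X0. \<forall>X\<ge>X0. \<forall>r\<ge>4*X. \<exists>s\<ge>4 * max_modulus X f. sphere 0 s \<subseteq> f ` cball 0 r"
proof -
  have hol: "f holomorphic_on UNIV"
    using f by (simp add: transcendental_entire_def)
  let ?K = schottky_const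
  have K: "?K > 0" "?K \<ge> 1"
    by (rule schottky_const_pos) (simp add: schottky_const_def)
  \<comment> \<open>With \<open>s\<close> four times M(X), the factor 8 makes M(2X) at least twice
    the threshold \<open>schottky_const * s\<close>, so Bohr's strict inequality holds.\<close>
  obtain X1 where X1: "\<And>X. X \<ge> X1 \<Longrightarrow> 8 * ?K * max_modulus X f \<le> max_modulus (2 * X) f"
    using max_modulus_doubling[OF f] by blast
  obtain X2 where X2: "\<And>X. X \<ge> X2 \<Longrightarrow> X + 1 \<le> max_modulus X f"
    using max_modulus_superlinear[OF f] by blast
  have "\<exists>s\<ge>4 * max_modulus X f. sphere 0 s \<subseteq> f ` cball 0 r"
    if X: "X \<ge> max 1 (max X1 X2)" and r: "r \<ge> 4 * X" for X r
  proof -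
    have MX: "max_modulus X f > 0"
      using X2[of X] X by auto
    \<comment> \<open>The factor 4 reproduces the assumption on \<open>r\<close> for the pair M(X),
      s, so that the lemma can be iterated.\<close>
    define s where "s = 4 * max_modulus X f"
    have s: "s > 0"
      using MX by (simp add: s_def)
    have "max_modulus (2 * X) f \<le> max_modulus (r / 2) f"
      using X r by (intro max_modulus_mono hol) auto
    then have big: "2 * (?K * s) \<le> max_modulus (r / 2) f"
      using X1[of X] X by (simp add: s_def)
    obtain z where z: "norm z = r / 2" "norm (f z) = max_modulus (r / 2) f"
      using max_modulus_attained[OF hol, of "r / 2"] X r by auto
    have "?K * s < norm (f z)"
      using big z K s by (smt (verit) mult_pos_pos)
    moreover have "norm (f 0) \<le> s"
      using norm_le_max_modulus[OF hol, of 0 X] X MX by (auto simp: s_def)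
    ultimately have "sphere 0 s \<subseteq> f ` cball 0 r \<or> sphere 0 (2 * s) \<subseteq> f ` cball 0 r"
      using X r z s by (intro Bohr_circle) (auto intro: holomorphic_on_subset[OF hol])
    then show ?thesis
      using s unfolding s_def by (metis dual_order.refl mult_2 add_increasing less_imp_le)
  qed
  then show ?thesis
    by blast
qed

lemma holomorphic_funpow:
  "f holomorphic_on UNIV \<Longrightarrow> (f ^^ n) holomorphic_on UNIV"
  by (induction n) (auto simp: id_def o_def
      intro: holomorphic_on_compose_gen[of _ UNIV f UNIV, unfolded o_def])

lemma continuous_on_funpow:
  "f holomorphic_on UNIV \<Longrightarrow> continuous_on S (f ^^ n)" for f :: "complex \<Rightarrow> complex"
  by (meson continuous_on_subset holomorphic_funpow holomorphic_on_imp_continuous_on subset_UNIV)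

text \<open>Induction on \<open>n\<close>: the image of the disc of radius \<open>r\<close> covers a
  circle of radius at least 4 M(X), to which the induction hypothesis applies with M(X) for
  X.\<close>

lemma max_modulus_iterate_ge:
  assumes f: "transcendental_entire f"
  shows "\<exists>X0. \<forall>X\<ge>X0. X + 1 \<le> max_modulus X f \<and>
    (\<forall>r\<ge>4*X. \<forall>n. \<exists>z\<in>sphere 0 r. ((\<lambda>r. max_modulus r f) ^^ n) X \<le> norm ((f ^^ n) z))"
proof -
  have hol: "f holomorphic_on UNIV"
    using f by (simp add: transcendental_entire_def)
  let ?M = "\<lambda>r. max_modulus r f"
  obtain X1 where X1: "\<And>X r. X \<ge> X1 \<Longrightarrow> r \<ge> 4 * X \<Longrightarrow> \<exists>s\<ge>4 * ?M X. sphere 0 s \<subseteq> f ` cball 0 r"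
    using image_contains_large_circle[OF f] by blast
  obtain X2 where X2: "\<And>X. X \<ge> X2 \<Longrightarrow> X + 1 \<le> ?M X"
    using max_modulus_superlinear[OF f] by blast
  define X0 where "X0 = max 1 (max X1 X2)"
  have "\<exists>z\<in>sphere 0 r. (?M ^^ n) X \<le> norm ((f ^^ n) z)" if "X \<ge> X0" "r \<ge> 4 * X" for n X r
    using that
  proof (induction n arbitrary: X r)
    case 0
    then have "r \<ge> X" "r \<ge> 0" by (auto simp: X0_def)
    then show ?case
      by (intro bexI[of _ "of_real r"]) auto
  next
    case (Suc n)
    obtain s where s: "s \<ge> 4 * ?M X" "sphere 0 s \<subseteq> f ` cball 0 r"
      using X1[of X r] Suc.prems by (auto simp: X0_def)
    have "?M X \<ge> X0"
      using X2[of X] Suc.prems by (auto simp: X0_def)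
    then obtain w where w: "w \<in> sphere 0 s" "(?M ^^ n) (?M X) \<le> norm ((f ^^ n) w)"
      using Suc.IH s(1) by blast
    then obtain z where z: "norm z \<le> r" "w = f z"
      using s(2) by auto
    \<comment> \<open>The preimage \<open>z\<close> is only known to lie in the disc; the maximum
      principle for the iterate moves it to the circle.\<close>
    have "norm ((f ^^ Suc n) z) \<le> max_modulus r (f ^^ Suc n)"
      using z by (intro norm_le_max_modulus holomorphic_funpow hol)
    moreover obtain y where "norm y = r" "norm ((f ^^ Suc n) y) = max_modulus r (f ^^ Suc n)"
    proof (rule max_modulus_attained[OF holomorphic_funpow[OF hol]])
      show "0 \<le> r"
        using Suc.prems by (auto simp: X0_def)
    qed
    moreover have "(?M ^^ Suc n) X = (?M ^^ n) (?M X)" "(f ^^ Suc n) z = (f ^^ n) w"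
      using z(2) by (simp_all add: funpow_Suc_right del: funpow.simps)
    ultimately show ?case
      using w(2) by (intro bexI[of _ y]) auto
  qed
  moreover have "X + 1 \<le> ?M X" if "X \<ge> X0" for X
    using X2 that by (auto simp: X0_def)
  ultimately show ?thesis
    by blast
qed

section \<open>Fatou, Julia and escaping sets\<close>

lemma open_funpow_image:
  assumes "transcendental_entire f" "open U"
  shows "open ((f ^^ n) ` U)"
proof (induction n)
  case (Suc n)
  have "(f ^^ Suc n) ` U = f ` (f ^^ n) ` U"
    by (simp add: image_comp)
  then show ?case
    using open_image_transcendental_entire[OF assms(1) Suc] by simp
qed (use assms in simp)

lemma bounded_continuous_image:
  fixes h :: "complex \<Rightarrow> complex"
  assumes "continuous_on UNIV h" "bounded U"
  shows "bounded (h ` U)"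
proof -
  have "bounded (h ` closure U)"
    using assms by (intro compact_imp_bounded compact_continuous_image)
      (auto intro: continuous_on_subset)
  then show ?thesis
    by (meson bounded_subset closure_subset image_mono)
qed

text \<open>By compactness each frontier point has a preimage in \<open>closure U\<close>; as the
  image is open, this preimage is not in the interior. Domains thus keep their frontiers in a
  forward invariant set under iteration.\<close>

lemma frontier_open_image_subset:
  fixes h :: "complex \<Rightarrow> complex"
  assumes "continuous_on UNIV h" "bounded U" "open (h ` U)"
  shows "frontier (h ` U) \<subseteq> h ` frontier U"
proof
  fix y assume y: "y \<in> frontier (h ` U)"
  have "compact (h ` closure U)"
    using assms by (intro compact_continuous_image) (auto intro: continuous_on_subset)
  then have "closure (h ` U) \<subseteq> h ` closure U"
    by (intro closure_minimal image_mono closure_subset compact_imp_closed)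
  then obtain x where x: "x \<in> closure U" "y = h x"
    using y by (auto simp: frontier_def)
  have "y \<notin> h ` U"
    using y assms(3) by (simp add: frontier_def interior_open)
  then have "x \<notin> interior U"
    using x interior_subset by blast
  then show "y \<in> h ` frontier U"
    using x by (auto simp: frontier_def)
qed

lemma open_fatou_set: "open (fatou_set f)"
  unfolding fatou_set_def by (subst open_subopen) blast

text \<open>Normality near \<open>f z\<close> is pulled back along \<open>f\<close> by writing a
  positive iterate as a lower one composed with \<open>f\<close>.\<close>

lemma fatou_set_backward:
  assumes f: "f holomorphic_on UNIV" and fz: "f z \<in> fatou_set f"
  shows "z \<in> fatou_set f"
proof -
  obtain U where U: "open U" "f z \<in> U" "normal_family (range (\<lambda>n. f ^^ n)) U"
    using fz by (auto simp: fatou_set_def)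
  have contf: "continuous_on UNIV f"
    using f by (rule holomorphic_on_imp_continuous_on)
  have "normal_family (range (\<lambda>n. f ^^ n)) (f -` U)"
    unfolding normal_family_def
  proof (intro allI impI)
    fix s :: "nat \<Rightarrow> complex \<Rightarrow> complex"
    assume "\<forall>j. s j \<in> range (\<lambda>n. f ^^ n)"
    then have "\<forall>j. \<exists>n. s j = f ^^ n"
      by blast
    then obtain n where n: "\<And>j. s j = f ^^ (n j)"
      by metis
    show "\<exists>r. strict_mono r \<and>
           ((\<exists>g. \<forall>K. compact K \<and> K \<subseteq> f -` U \<longrightarrow> uniform_limit K (s \<circ> r) g sequentially) \<or>
            (\<forall>K. compact K \<and> K \<subseteq> f -` U \<longrightarrow>
               (\<forall>B. eventually (\<lambda>j. \<forall>z\<in>K. B < norm ((s \<circ> r) j z)) sequentially)))"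
    \<comment> \<open>The exponent 0 has no lower iterate; if it recurs infinitely often, the
      constant subsequence \<open>id\<close> converges.\<close>
    proof (cases "infinite {j. n j = 0}")
      case True
      then obtain r :: "nat \<Rightarrow> nat" where r: "strict_mono r" "\<And>j. n (r j) = 0"
        using infinite_enumerate by blast
      have "s \<circ> r = (\<lambda>j. id)"
        using r(2) n by (auto simp: fun_eq_iff)
      then show ?thesis
        using r(1) by (intro exI[of _ r] conjI disjI1 exI[of _ id]) (auto simp: uniform_limit_const)
    next
      case False
      have "UNIV = {j. n j = 0} \<union> {j. 0 < n j}"
        by auto
      then have "infinite {j. 0 < n j}"
        using False by (metis finite_UnI infinite_UNIV_nat)
      then obtain r :: "nat \<Rightarrow> nat" where r: "strict_mono r" "\<And>j. 0 < n (r j)"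
        using infinite_enumerate by blast
      define t where "t j = f ^^ (n (r j) - 1)" for j
      have st: "s (r j) x = t j (f x)" for j x
        using r(2)[of j] n[of "r j"] by (cases "n (r j)") (auto simp: t_def funpow_swap1)
      have "\<forall>j. t j \<in> range (\<lambda>n. f ^^ n)"
        by (auto simp: t_def)
      then obtain k where k: "strict_mono k"
        and lim: "(\<exists>g. \<forall>K. compact K \<and> K \<subseteq> U \<longrightarrow> uniform_limit K (t \<circ> k) g sequentially) \<or>
            (\<forall>K. compact K \<and> K \<subseteq> U \<longrightarrow>
               (\<forall>B. eventually (\<lambda>j. \<forall>z\<in>K. B < norm ((t \<circ> k) j z)) sequentially))"
        using U(3) unfolding normal_family_def by blast
      have img: "compact (f ` K) \<and> f ` K \<subseteq> U" if "compact K \<and> K \<subseteq> f -` U" for K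
        using that contf by (auto intro!: compact_continuous_image continuous_on_subset[OF contf])
      have rk: "strict_mono (r \<circ> k)"
        using r(1) k by (rule strict_mono_o)
      show ?thesis
        using lim
      proof
        assume "\<exists>g. \<forall>K. compact K \<and> K \<subseteq> U \<longrightarrow> uniform_limit K (t \<circ> k) g sequentially"
        then obtain g where g: "\<And>K. compact K \<and> K \<subseteq> U \<Longrightarrow> uniform_limit K (t \<circ> k) g sequentially"
          by blast
        have "uniform_limit K (s \<circ> (r \<circ> k)) (g \<circ> f) sequentially" if "compact K \<and> K \<subseteq> f -` U" for K
          using g[OF img[OF that]] by (simp add: uniform_limit_iff st)
        then show ?thesis
          using rk by blast
      next
        assume inf: "\<forall>K. compact K \<and> K \<subseteq> U \<longrightarrow>
               (\<forall>B. eventually (\<lambda>j. \<forall>z\<in>K. B < norm ((t \<circ> k) j z)) sequentially)"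
        have "\<forall>B. eventually (\<lambda>j. \<forall>z\<in>K. B < norm ((s \<circ> (r \<circ> k)) j z)) sequentially"
          if "compact K \<and> K \<subseteq> f -` U" for K
          using inf[rule_format, OF img[OF that]] by (simp add: st)
        then show ?thesis
          using rk by blast
      qed
    qed
  qed
  moreover have "open (f -` U)"
    using contf U(1) by (simp add: continuous_on_open_vimage)
  ultimately show ?thesis
    using U(2) by (auto simp: fatou_set_def)
qed

lemma julia_set_forward:
  "f holomorphic_on UNIV \<Longrightarrow> f ` julia_set f \<subseteq> julia_set f"
  using fatou_set_backward by (auto simp: julia_set_def)

lemma escaping_set_iff_eventually:
  "z \<in> escaping_set f \<longleftrightarrow> (\<forall>B. \<exists>N. \<forall>n\<ge>N. B < norm ((f ^^ n) z))"
  by (simp add: escaping_set_def filterlim_at_top_dense eventually_sequentially)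

lemma funpow_escaping_iff: "(f ^^ m) z \<in> escaping_set f \<longleftrightarrow> z \<in> escaping_set f"
proof -
  have "(f ^^ n) ((f ^^ m) z) = (f ^^ (n + m)) z" for n
    by (simp add: funpow_add)
  then show ?thesis
    unfolding escaping_set_def filterlim_at_top mem_Collect_eq
    by (simp add: eventually_sequentially_seg[where P = "\<lambda>n. _ \<le> norm ((f ^^ n) z)"])
qed

lemma escaping_set_forward: "f ` escaping_set f \<subseteq> escaping_set f"
  using funpow_escaping_iff[where f = f and m = 1] by auto

text \<open>If \<open>b\<close> returned to a bounded set along a subsequence while \<open>a\<close>
  escaped, no further subsequence could converge at \<open>a\<close> or diverge at \<open>b\<close>,
  against normality on a common neighbourhood.\<close>

lemma escaping_locally_constant_on_fatou:
  assumes "z \<in> fatou_set f"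
  obtains U where "open U" "z \<in> U"
    "\<And>a b. a \<in> U \<Longrightarrow> b \<in> U \<Longrightarrow> a \<in> escaping_set f \<Longrightarrow> b \<in> escaping_set f"
proof -
  obtain U where U: "open U" "z \<in> U" "normal_family (range (\<lambda>n. f ^^ n)) U"
    using assms by (auto simp: fatou_set_def)
  have "b \<in> escaping_set f" if ab: "a \<in> U" "b \<in> U" "a \<in> escaping_set f" for a b
  proof (rule ccontr)
    assume "b \<notin> escaping_set f"
    then obtain B where B: "\<And>N. \<exists>n\<ge>N. norm ((f ^^ n) b) \<le> B"
      unfolding escaping_set_iff_eventually by (metis not_le)
    then have "infinite {n. norm ((f ^^ n) b) \<le> B}"
      unfolding infinite_nat_iff_unbounded_le by simp
    then obtain r :: "nat \<Rightarrow> nat" where r: "strict_mono r" "\<And>j. norm ((f ^^ (r j)) b) \<le> B"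
      using infinite_enumerate by blast
    obtain k where k: "strict_mono k"
      and lim: "(\<exists>g. \<forall>K. compact K \<and> K \<subseteq> U \<longrightarrow> uniform_limit K ((\<lambda>j. f ^^ r j) \<circ> k) g sequentially) \<or>
            (\<forall>K. compact K \<and> K \<subseteq> U \<longrightarrow>
               (\<forall>B. eventually (\<lambda>j. \<forall>z\<in>K. B < norm (((\<lambda>j. f ^^ r j) \<circ> k) j z)) sequentially))"
      using U(3)[unfolded normal_family_def, rule_format, of "\<lambda>j. f ^^ r j"] by blast
    from lim show False
    proof
      assume "\<exists>g. \<forall>K. compact K \<and> K \<subseteq> U \<longrightarrow> uniform_limit K ((\<lambda>j. f ^^ r j) \<circ> k) g sequentially"
      then obtain g where "uniform_limit {a} ((\<lambda>j. f ^^ r j) \<circ> k) g sequentially"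
        using ab(1) by (metis compact_sing empty_subsetI insert_subset)
      then have "(\<lambda>j. (f ^^ r (k j)) a) \<longlonglongrightarrow> g a"
        by (auto dest: tendsto_uniform_limitI[where x = a])
      then have "\<forall>\<^sub>F j in sequentially. norm ((f ^^ r (k j)) a) < norm (g a) + 1"
        by (intro order_tendstoD(2)[OF tendsto_norm]) auto
      moreover have "filterlim (\<lambda>j. norm ((f ^^ (r \<circ> k) j) a)) at_top sequentially"
        using ab(3) filterlim_compose[OF _ filterlim_subseq[OF strict_mono_o[OF r(1) k]],
            of "\<lambda>n. norm ((f ^^ n) a)"]
        by (simp add: escaping_set_def)
      then have "\<forall>\<^sub>F j in sequentially. norm (g a) + 1 \<le> norm ((f ^^ r (k j)) a)"
        by (simp add: filterlim_at_top)
      ultimately have "\<forall>\<^sub>F j in sequentially. False"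
        by eventually_elim simp
      then show False
        by simp
    next
      assume inf: "\<forall>K. compact K \<and> K \<subseteq> U \<longrightarrow>
        (\<forall>B. eventually (\<lambda>j. \<forall>z\<in>K. B < norm (((\<lambda>j. f ^^ r j) \<circ> k) j z)) sequentially)"
      have "eventually (\<lambda>j. \<forall>z\<in>{b}. B < norm (((\<lambda>j. f ^^ r j) \<circ> k) j z)) sequentially"
        using ab(2) by (intro inf[rule_format]) simp
      then obtain j where "B < norm ((f ^^ r (k j)) b)"
        by (auto simp: eventually_sequentially)
      then show False
        using r(2)[of "k j"] by simp
    qed
  qed
  then show ?thesis
    using that U by blast
qed

lemma connected_fatou_subset_escaping:
  assumes "connected W" "W \<subseteq> fatou_set f" "W \<inter> escaping_set f \<noteq> {}"
  shows "W \<subseteq> escaping_set f"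
proof
  fix b assume b: "b \<in> W"
  obtain a where a: "a \<in> W" "a \<in> escaping_set f"
    using assms(3) by blast
  show "b \<in> escaping_set f"
  proof (rule connected_induction_simple[OF assms(1), where P = "\<lambda>x. x \<in> escaping_set f" and a = a])
    fix x assume x: "x \<in> W"
    obtain U where "open U" "x \<in> U"
      "\<And>a b. a \<in> U \<Longrightarrow> b \<in> U \<Longrightarrow> a \<in> escaping_set f \<Longrightarrow> b \<in> escaping_set f"
      using escaping_locally_constant_on_fatou[of x f] assms(2) x by blast
    then show "\<exists>T. openin (top_of_set W) T \<and> x \<in> T \<and>
        (\<forall>a\<in>T. \<forall>b\<in>T. a \<in> escaping_set f \<longrightarrow> b \<in> escaping_set f)"
      using x by (intro exI[of _ "W \<inter> U"]) (auto simp: openin_open_Int)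
  qed (use a b in auto)
qed

section \<open>Nonemptiness of the Julia set and blow-up near its points\<close>

lemma julia_set_nonempty:
  assumes f: "transcendental_entire f" and I: "escaping_set f \<noteq> {}"
  shows "julia_set f \<noteq> {}"
proof
  assume "julia_set f = {}"
  then have "fatou_set f = UNIV"
    by (auto simp: julia_set_def)
  then have all: "escaping_set f = UNIV"
    using connected_fatou_subset_escaping[of UNIV f] I by auto
  have "f \<noteq> (\<lambda>x. a + x)" for a
  proof
    assume "f = (\<lambda>x. a + x)"
    then have "\<forall>z. f z = poly [:a, 1:] z"
      by simp
    then show False
      using f unfolding transcendental_entire_def by blast
  qed
  \<comment> \<open>\<open>f\<close> itself may have no fixed point, but its second iterate has one
    because \<open>f\<close> is not a translation.\<close>
  then obtain p where p: "f (f p) = p"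
    using holomorphic_involution_point[of f] f by (auto simp: transcendental_entire_def)
  have per: "(f ^^ (2 * n)) p = p" for n
    by (induction n) (simp_all add: p)
  obtain N where "\<forall>n\<ge>N. norm p < norm ((f ^^ n) p)"
    using all escaping_set_iff_eventually[of p f] by blast
  from this[rule_format, of "2 * N"] show False
    by (simp add: per)
qed

text \<open>If no iterate covered the circle of radius s or that of radius 2s, the Montel criterion
  would make \<open>U\<close> part of the Fatou set. Either circle may be the covered one, hence
  only \<open>t \<ge> s\<close>.\<close>

lemma julia_blowup:
  assumes f: "transcendental_entire f" and U: "open U" "connected U" "U \<inter> julia_set f \<noteq> {}"
    and s: "0 < s"
  shows "\<exists>n. \<exists>t\<ge>s. sphere 0 t \<subseteq> (f ^^ n) ` U"
proof (rule ccontr)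
  assume not: "\<not> ?thesis"
  have "\<exists>a. norm a = s \<and> a \<notin> (f ^^ n) ` U" "\<exists>b. norm b = 2 * s \<and> b \<notin> (f ^^ n) ` U" for n
  proof -
    have "\<not> sphere 0 s \<subseteq> (f ^^ n) ` U" "\<not> sphere 0 (2 * s) \<subseteq> (f ^^ n) ` U"
      using not s by auto
    then show "\<exists>a. norm a = s \<and> a \<notin> (f ^^ n) ` U" "\<exists>b. norm b = 2 * s \<and> b \<notin> (f ^^ n) ` U"
      by auto
  qed
  then obtain a b where a: "\<And>n. norm (a n) = s" "\<And>n. a n \<notin> (f ^^ n) ` U"
    and b: "\<And>n. norm (b n) = 2 * s" "\<And>n. b n \<notin> (f ^^ n) ` U"
    by metis
  have "normal_family (range (\<lambda>n. f ^^ n)) U"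
    unfolding normal_family_def
  proof (intro allI impI)
    fix F :: "nat \<Rightarrow> complex \<Rightarrow> complex"
    assume "\<forall>j. F j \<in> range (\<lambda>n. f ^^ n)"
    then have "\<forall>j. \<exists>n. F j = f ^^ n"
      by blast
    then obtain n where n: "\<And>j. F j = f ^^ (n j)"
      by metis
    have "F j holomorphic_on U" for j
      using f holomorphic_funpow[of f "n j"] n
      by (auto simp: transcendental_entire_def intro: holomorphic_on_subset)
    then show "\<exists>r. strict_mono r \<and>
           ((\<exists>g. \<forall>K. compact K \<and> K \<subseteq> U \<longrightarrow> uniform_limit K (F \<circ> r) g sequentially) \<or>
            (\<forall>K. compact K \<and> K \<subseteq> U \<longrightarrow>
               (\<forall>B. eventually (\<lambda>j. \<forall>z\<in>K. B < norm ((F \<circ> r) j z)) sequentially)))"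
      by (rule Montel_omitting_circle_points[OF U(1,2) _ s,
            where a = "\<lambda>j. a (n j)" and b = "\<lambda>j. b (n j)"]) (use a b n in auto)
  qed
  then have "U \<subseteq> fatou_set f"
    using U(1) by (auto simp: fatou_set_def)
  then show False
    using U(3) by (auto simp: julia_set_def)
qed

lemma separates_imp_web_sequence:
  assumes f: "transcendental_entire f" and E: "f ` E \<subseteq> E"
    and z: "z \<in> julia_set f" "separates_from_infinity E z"
  shows "\<exists>G. web_sequence E G"
proof (rule web_sequence_exists)
  fix r :: real
  obtain U0 where U0: "open U0" "bounded U0" "z \<in> U0" "frontier U0 \<subseteq> E"
    using z(2) by (auto simp: separates_from_infinity_def)
  \<comment> \<open>Passing to a component keeps the frontier in \<open>E\<close> and supplies the
    connectedness needed for the blow-up.\<close>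
  define U where "U = connected_component_set U0 z"
  have U: "open U" "connected U" "z \<in> U"
    using U0 by (auto simp: U_def open_connected_component)
  have bU: "bounded U"
    using U0(2) unfolding U_def by (meson bounded_subset connected_component_subset)
  have frU: "frontier U \<subseteq> E"
    using U0(4) frontier_of_connected_component_subset unfolding U_def by blast
  have "U \<inter> julia_set f \<noteq> {}" "0 < max r 1"
    using U(3) z(1) by auto
  then obtain n t where t: "max r 1 \<le> t" "sphere 0 t \<subseteq> (f ^^ n) ` U"
    using julia_blowup[OF f U(1,2)] by blast
  have hol: "f holomorphic_on UNIV"
    using f by (simp add: transcendental_entire_def)
  note cont = continuous_on_funpow[OF hol]
  have "(f ^^ n) ` E \<subseteq> E"
  proof (induction n)
    case (Suc n)
    then show ?case using E by auto
  qed simp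
  then have "frontier ((f ^^ n) ` U) \<subseteq> E"
    using frontier_open_image_subset[OF cont bU open_funpow_image[OF f U(1)], of n] frU by blast
  moreover have "connected ((f ^^ n) ` U)"
    by (intro connected_continuous_image cont U(2))
  ultimately show "\<exists>T s. open T \<and> connected T \<and> bounded T \<and> frontier T \<subseteq> E \<and> r \<le> s \<and> sphere 0 s \<subseteq> T"
    using open_funpow_image[OF f U(1), of n] bounded_continuous_image[OF cont bU, of n] t
    by (intro exI[of _ "(f ^^ n) ` U"] exI[of _ t]) auto
qed

text \<open>The maximum principle pushes a fast growing orbit out to the boundary.\<close>

lemma fast_orbit_on_frontier:
  assumes f: "transcendental_entire f" and W: "bounded W"
    and ge: "\<And>n. \<exists>z\<in>W. ((\<lambda>r. max_modulus r f) ^^ n) R \<le> norm ((f ^^ (n + l)) z)"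
  obtains z where "z \<in> frontier W" "\<And>n. ((\<lambda>r. max_modulus r f) ^^ n) R \<le> norm ((f ^^ (n + l)) z)"
proof -
  have hol: "f holomorphic_on UNIV"
    using f by (simp add: transcendental_entire_def)
  let ?M = "\<lambda>r. max_modulus r f"
  \<comment> \<open>These compact sets are nonempty by the maximum principle and decrease by
    \<open>norm_less_max_modulus\<close>; a common point is large at all times simultaneously,
    whereas the given points of \<open>W\<close> may depend on \<open>n\<close>.\<close>
  define K where "K n = frontier W \<inter> {z. (?M ^^ n) R \<le> norm ((f ^^ (n + l)) z)}" for n
  have fr: "compact (frontier W)" "frontier W \<noteq> {}"
  proof -
    show "compact (frontier W)"
      using W by (rule compact_frontier_bounded)
    have "W \<noteq> {}" "W \<noteq> UNIV"
      using ge W not_bounded_UNIV by auto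
    then show "frontier W \<noteq> {}"
      by (rule frontier_not_empty)
  qed
  have "compact (K n)" for n
    unfolding K_def
    by (intro compact_Int_closed fr closed_Collect_le continuous_on_const continuous_on_norm
        continuous_on_funpow hol)
  moreover have "K n \<noteq> {}" for n
  proof -
    have "continuous_on (frontier W) (\<lambda>z. norm ((f ^^ (n + l)) z))"
      by (intro continuous_on_norm continuous_on_funpow hol)
    then obtain y where y: "y \<in> frontier W"
      "\<forall>w\<in>frontier W. norm ((f ^^ (n + l)) w) \<le> norm ((f ^^ (n + l)) y)"
      using continuous_attains_sup[OF fr] by blast
    obtain z where z: "z \<in> W" "(?M ^^ n) R \<le> norm ((f ^^ (n + l)) z)"
      using ge by blast
    have "norm ((f ^^ (n + l)) z) \<le> norm ((f ^^ (n + l)) y)"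
      by (rule maximum_modulus_frontier[of _ W])
        (use y z W in \<open>auto intro: continuous_on_funpow hol holomorphic_on_subset[OF holomorphic_funpow[OF hol]]\<close>)
    then show ?thesis
      using y(1) z(2) by (auto simp: K_def)
  qed
  moreover have "K n \<subseteq> K m" if "m \<le> n" for m n
    using that
  proof (rule lift_Suc_antimono_le[rotated])
    show "K (Suc i) \<subseteq> K i" for i
      using norm_less_max_modulus[OF f] by (auto simp: K_def simp flip: not_less)
  qed
  ultimately have "\<Inter>(range K) \<noteq> {}"
    by (rule compact_nest)
  then show ?thesis
    using that by (auto simp: K_def)
qed

text \<open>The definition gives bounds only for n at least 1, while
  \<open>fast_orbit_on_frontier\<close> starts at 0; replacing R by M(R) and l by l + 1 reconciles
  the two.\<close>

lemma fast_escaping_meets_frontier: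
  assumes f: "transcendental_entire f" and "bounded W" "W \<inter> fast_escaping_set f R \<noteq> {}"
  shows "frontier W \<inter> fast_escaping_set f R \<noteq> {}"
proof -
  let ?M = "\<lambda>r. max_modulus r f"
  obtain z l where z: "z \<in> W" "l \<ge> 1" and zl: "\<And>n. n \<ge> 1 \<Longrightarrow> (?M ^^ n) R \<le> norm ((f ^^ (n + l)) z)"
    using assms(3) by (auto simp: fast_escaping_set_def)
  have shift: "(?M ^^ n) (?M R) = (?M ^^ Suc n) R" for n
    by (simp add: funpow_Suc_right del: funpow.simps)
  have "\<exists>z\<in>W. (?M ^^ n) (?M R) \<le> norm ((f ^^ (n + Suc l)) z)" for n
    using zl[of "Suc n"] z(1) unfolding shift by auto
  then obtain y where y: "y \<in> frontier W" "\<And>n. (?M ^^ n) (?M R) \<le> norm ((f ^^ (n + Suc l)) y)"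
    using fast_orbit_on_frontier[OF f assms(2)] by metis
  have "(?M ^^ n) R \<le> norm ((f ^^ (n + l)) y)" if "n \<ge> 1" for n
    using y(2)[of "n - 1"] that unfolding shift by (cases n) auto
  then show ?thesis
    using y(1) z(2) by (auto simp: fast_escaping_set_def)
qed

section \<open>Invariance and escape of the fast escaping set\<close>

lemma max_modulus_iterates_mono:
  assumes "f holomorphic_on UNIV" "0 \<le> a" "a \<le> b"
  shows "0 \<le> ((\<lambda>r. max_modulus r f) ^^ n) a \<and>
    ((\<lambda>r. max_modulus r f) ^^ n) a \<le> ((\<lambda>r. max_modulus r f) ^^ n) b"
  by (induction n) (use assms in \<open>auto intro: max_modulus_mono max_modulus_nonneg\<close>)

text \<open>If M(R) were below R, monotonicity would trap all iterates in [0, R].\<close>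

lemma max_modulus_iterates_incseq:
  assumes f: "f holomorphic_on UNIV" and R: "0 \<le> R"
    and lim: "filterlim (\<lambda>n. ((\<lambda>r. max_modulus r f) ^^ n) R) at_top sequentially"
  shows "((\<lambda>r. max_modulus r f) ^^ n) R \<le> ((\<lambda>r. max_modulus r f) ^^ Suc n) R"
proof -
  let ?M = "\<lambda>r. max_modulus r f"
  have "R \<le> ?M R"
  proof (rule ccontr)
    assume "\<not> R \<le> ?M R"
    then have less: "?M R < R" by simp
    have "0 \<le> (?M ^^ n) R \<and> (?M ^^ n) R \<le> R" for n
    proof (induction n)
      case (Suc n)
      then have "?M ((?M ^^ n) R) \<le> ?M R"
        by (intro max_modulus_mono f) auto
      then show ?case
        using Suc less max_modulus_nonneg[OF f, of "(?M ^^ n) R"] by auto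
    qed (use R in simp)
    moreover have "\<forall>\<^sub>F n in sequentially. R < (?M ^^ n) R"
      using lim unfolding filterlim_at_top_dense by blast
    then obtain n where "R < (?M ^^ n) R"
      by (auto simp: eventually_sequentially)
    ultimately show False
      by (meson not_le)
  qed
  then have "(?M ^^ n) R \<le> (?M ^^ n) (?M R)"
    using max_modulus_iterates_mono[OF f R] by blast
  then show ?thesis
    by (simp add: funpow_Suc_right del: funpow.simps)
qed

lemma fast_escaping_set_forward:
  assumes "f holomorphic_on UNIV" "0 \<le> R"
    "filterlim (\<lambda>n. ((\<lambda>r. max_modulus r f) ^^ n) R) at_top sequentially"
  shows "f ` fast_escaping_set f R \<subseteq> fast_escaping_set f R"
proof
  let ?M = "\<lambda>r. max_modulus r f"
  fix w assume "w \<in> f ` fast_escaping_set f R"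
  then obtain z l where z: "w = f z" "l \<ge> 1"
    and zl: "\<And>n. n \<ge> 1 \<Longrightarrow> (?M ^^ n) R \<le> norm ((f ^^ (n + l)) z)"
    by (auto simp: fast_escaping_set_def)
  have "(?M ^^ n) R \<le> norm ((f ^^ (n + l)) w)" if "n \<ge> 1" for n
  proof -
    have "(?M ^^ n) R \<le> (?M ^^ Suc n) R"
      by (rule max_modulus_iterates_incseq[OF assms])
    also have "\<dots> \<le> norm ((f ^^ (Suc n + l)) z)"
      by (rule zl) simp
    also have "(f ^^ (Suc n + l)) z = (f ^^ (n + l)) w"
      by (simp add: z(1) funpow_swap1)
    finally show ?thesis .
  qed
  then show "w \<in> fast_escaping_set f R"
    using z(2) by (auto simp: fast_escaping_set_def)
qed

lemma fast_escaping_subset_escaping: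
  assumes "filterlim (\<lambda>n. ((\<lambda>r. max_modulus r f) ^^ n) R) at_top sequentially"
  shows "fast_escaping_set f R \<subseteq> escaping_set f"
proof
  let ?M = "\<lambda>r. max_modulus r f"
  fix z assume "z \<in> fast_escaping_set f R"
  then obtain l where zl: "\<And>n. n \<ge> 1 \<Longrightarrow> (?M ^^ n) R \<le> norm ((f ^^ (n + l)) z)"
    by (auto simp: fast_escaping_set_def)
  then have "\<forall>\<^sub>F n in sequentially. (?M ^^ n) R \<le> norm ((f ^^ (n + l)) z)"
    by (auto simp: eventually_sequentially)
  then have "filterlim (\<lambda>n. norm ((f ^^ n) ((f ^^ l) z))) at_top sequentially"
    using filterlim_at_top_mono[OF assms] by (simp add: funpow_add)
  then have "(f ^^ l) z \<in> escaping_set f"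
    by (simp add: escaping_set_def)
  then show "z \<in> escaping_set f"
    by (simp add: funpow_escaping_iff)
qed

text \<open>An image of \<open>W\<close> covers a circle on which every iterate is large somewhere.
  The points depend on \<open>n\<close>, but \<open>fast_orbit_on_frontier\<close> replaces them by
  one frontier point, which escapes because the iterates of M diverge.\<close>

lemma escaping_meets_frontier_of_julia_neighbourhood:
  assumes f: "transcendental_entire f" and W: "open W" "connected W" "bounded W"
    and J: "W \<inter> julia_set f \<noteq> {}"
  shows "frontier W \<inter> escaping_set f \<noteq> {}"
proof -
  let ?M = "\<lambda>r. max_modulus r f"
  obtain X0 where X0: "\<And>X. X \<ge> X0 \<Longrightarrow> X + 1 \<le> ?M X"
    "\<And>X r n. X \<ge> X0 \<Longrightarrow> r \<ge> 4 * X \<Longrightarrow> \<exists>z\<in>sphere 0 r. (?M ^^ n) X \<le> norm ((f ^^ n) z)"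
    using max_modulus_iterate_ge[OF f] by blast
  define X where "X = max 1 X0"
  obtain l t where t: "4 * X \<le> t" "sphere 0 t \<subseteq> (f ^^ l) ` W"
    using julia_blowup[OF f W(1,2) J, of "4 * X"] by (auto simp: X_def)
  have "\<exists>z\<in>W. (?M ^^ n) X \<le> norm ((f ^^ (n + l)) z)" for n
  proof -
    obtain y where y: "y \<in> sphere 0 t" "(?M ^^ n) X \<le> norm ((f ^^ n) y)"
      using X0(2)[of X t n] t(1) by (auto simp: X_def)
    then obtain w where "w \<in> W" "y = (f ^^ l) w"
      using t(2) by blast
    then show ?thesis
      using y(2) by (auto simp: funpow_add)
  qed
  then obtain z where z: "z \<in> frontier W" "\<And>n. (?M ^^ n) X \<le> norm ((f ^^ (n + l)) z)"
    using fast_orbit_on_frontier[OF f W(3)] by metis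
  have grow: "X + real n \<le> (?M ^^ n) X" for n
  proof (induction n)
    case (Suc n)
    then have "(?M ^^ n) X \<ge> X0"
      by (auto simp: X_def)
    then show ?case
      using X0(1)[of "(?M ^^ n) X"] Suc by simp
  qed simp
  have "filterlim (\<lambda>n. norm ((f ^^ n) ((f ^^ l) z))) at_top sequentially"
  proof (rule filterlim_at_top_mono[OF filterlim_real_sequentially])
    have "real n \<le> norm ((f ^^ n) ((f ^^ l) z))" for n
      using grow[of n] z(2)[of n] by (auto simp: X_def funpow_add)
    then show "\<forall>\<^sub>F n in sequentially. real n \<le> norm ((f ^^ n) ((f ^^ l) z))"
      by simp
  qed
  then have "(f ^^ l) z \<in> escaping_set f"
    by (simp add: escaping_set_def)
  then show ?thesis
    using z(1) by (auto simp: funpow_escaping_iff)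
qed

section \<open>Frontiers of bounded domains\<close>

lemma connected_subset_or_disjoint:
  assumes "connected S" "S \<inter> frontier T = {}"
  shows "S \<subseteq> T \<or> S \<inter> T = {}"
  using connected_Int_frontier[OF assms(1), of T] assms(2) by blast

text \<open>In the Fatou case all images \<open>T m\<close> of \<open>W\<close> are pairwise disjoint, and a frontier in the web
  lies in at most one of them; the later images are trapped outside \<open>G k\<close>, closures included.\<close>

lemma escaping_meets_frontier:
  assumes f: "transcendental_entire f" and G: "web_sequence (escaping_set f) G"
    and W: "open W" "connected W" "bounded W" "W \<inter> escaping_set f \<noteq> {}"
  shows "frontier W \<inter> escaping_set f \<noteq> {}"
proof (cases "W \<inter> julia_set f = {}")
  case False
  then show ?thesis
    by (rule escaping_meets_frontier_of_julia_neighbourhood[OF f W(1-3)])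
next
  case True
  let ?I = "escaping_set f"
  have hol: "f holomorphic_on UNIV"
    using f by (simp add: transcendental_entire_def)
  note cont = continuous_on_funpow[OF hol]
  have WI: "W \<subseteq> ?I"
    using True W(2,4) by (intro connected_fatou_subset_escaping) (auto simp: julia_set_def)
  obtain z where z: "z \<in> W" "z \<in> ?I"
    using W(4) by blast
  show ?thesis
  proof
    assume fr: "frontier W \<inter> ?I = {}"
    define T where "T m = (f ^^ m) ` W" for m
    have T: "open (T m)" "connected (T m)" "bounded (T m)" "T m \<subseteq> ?I" "T m \<noteq> {}" for m
      unfolding T_def
      using open_funpow_image[OF f W(1)] connected_continuous_image[OF cont W(2)]
        bounded_continuous_image[OF cont W(3)] WI z by (auto simp: funpow_escaping_iff)
    have frT: "frontier (T m) \<inter> ?I = {}" for m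
    proof -
      have "frontier (T m) \<subseteq> (f ^^ m) ` frontier W"
        unfolding T_def by (rule frontier_open_image_subset[OF cont W(3) open_funpow_image[OF f W(1)]])
      then show ?thesis
        using fr funpow_escaping_iff[where f = f and m = m] by blast
    qed
    \<comment> \<open>\<open>T m\<close> consists of escaping points and
      \<open>frontier (T n)\<close> contains none, so a connected \<open>T m\<close> meeting
      \<open>T n\<close> stays inside it.\<close>
    have sub: "T m \<subseteq> T n" if "T m \<inter> T n \<noteq> {}" for m n
      using connected_subset_or_disjoint[OF T(2), of m "T n"] frT[of n] T(4)[of m] that by blast
    have disj: "T m \<inter> T n = {}" if "m < n" for m n
    proof (rule ccontr)
      assume "T m \<inter> T n \<noteq> {}"
      then have "T n \<subseteq> T m"
        using sub[of n m] by blast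
      \<comment> \<open>An overlap makes the \<open>d\<close>-th iterate map the bounded set
        \<open>T m\<close> into itself, although its points escape.\<close>
      define d where "d = n - m"
      have "n = d + m"
        using that by (simp add: d_def)
      then have "(f ^^ d) ` T m = T n"
        unfolding T_def by (simp add: funpow_add image_comp)
      then have step: "(f ^^ d) x \<in> T m" if "x \<in> T m" for x
        using \<open>T n \<subseteq> T m\<close> that by blast
      obtain y where y: "y \<in> T m"
        using T(5) by blast
      have iter: "(f ^^ (k * d)) y \<in> T m" for k
        by (induction k) (use y step in \<open>auto simp: funpow_add\<close>)
      obtain B where B: "\<And>x. x \<in> T m \<Longrightarrow> norm x \<le> B"
        using T(3) unfolding bounded_iff by blast
      obtain N where N: "\<And>i. i \<ge> N \<Longrightarrow> B < norm ((f ^^ i) y)"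
        using T(4) y escaping_set_iff_eventually by blast
      have "N * d \<ge> N"
        using that by (auto simp: d_def)
      then show False
        using N B[OF iter[of N]] by (meson not_le)
    qed
    \<comment> \<open>At most one \<open>T m\<close> meets \<open>frontier (G k)\<close>, since it
      then contains all of it. Late images avoid this frontier and contain an iterate of
      \<open>z\<close> outside \<open>G k\<close>, so they avoid \<open>G k\<close>.\<close>
    have away: "\<exists>N. \<forall>m\<ge>N. T m \<inter> G k = {}" for k
    proof -
      have Gk: "bounded (G k)" "frontier (G k) \<subseteq> ?I"
        using G by (auto simp: web_sequence_def)
      have absorb: "frontier (G k) \<subseteq> T m" if "frontier (G k) \<inter> T m \<noteq> {}" for m
        using connected_subset_or_disjoint[OF web_sequence_connected_frontier[OF G], of k "T m"]
          frT[of m] Gk(2) that by blast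
      have "\<exists>N. \<forall>m\<ge>N. frontier (G k) \<inter> T m = {}"
      proof (cases "\<exists>m. frontier (G k) \<inter> T m \<noteq> {}")
        case True
        then obtain m where m: "frontier (G k) \<inter> T m \<noteq> {}" ..
        have "frontier (G k) \<inter> T n = {}" if "n \<ge> Suc m" for n
          using absorb[OF m] disj[OF Suc_le_lessD[OF that]] by blast
        then show ?thesis by blast
      qed auto
      then obtain N where N: "\<And>m. m \<ge> N \<Longrightarrow> frontier (G k) \<inter> T m = {}"
        by blast
      obtain B where B: "\<And>x. x \<in> G k \<Longrightarrow> norm x \<le> B"
        using Gk(1) unfolding bounded_iff by blast
      obtain N' where N': "\<And>i. i \<ge> N' \<Longrightarrow> B < norm ((f ^^ i) z)"
        using z(2) escaping_set_iff_eventually by blast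
      have "T m \<inter> G k = {}" if "m \<ge> max N N'" for m
      proof -
        have "(f ^^ m) z \<in> T m" "(f ^^ m) z \<notin> G k"
          using z(1) N'[of m] B that by (auto simp: T_def simp flip: not_le)
        moreover have "frontier (G k) \<inter> T m = {}"
          using N that by simp
        ultimately show ?thesis
          using connected_subset_or_disjoint[OF T(2), of m "G k"] by blast
      qed
      then show ?thesis by blast
    qed
    have "frontier W \<subseteq> ?I"
    proof
      fix y assume "y \<in> frontier W"
      then have y: "y \<in> closure W"
        by (simp add: frontier_def)
      show "y \<in> ?I"
        unfolding escaping_set_iff_eventually
      proof
        fix B
        obtain k where k: "cball 0 B \<subseteq> G k"
          using web_sequence_covers_compact[OF G compact_cball] by blast
        obtain N where N: "\<And>m. m \<ge> N \<Longrightarrow> T m \<inter> G k = {}"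
          using away by blast
        have "B < norm ((f ^^ m) y)" if "m \<ge> N" for m
        proof -
          have "(f ^^ m) y \<in> closure (T m)"
            unfolding T_def using image_closure_subset[OF cont closed_closure closure_subset] y by blast
          moreover have "open (G k)"
            using G by (auto simp: web_sequence_def)
          then have "G k \<inter> closure (T m) = {}"
            using N[OF that] open_Int_closure_eq_empty[of "G k" "T m"] by blast
          ultimately have "(f ^^ m) y \<notin> cball 0 B"
            using k by blast
          then show ?thesis by simp
        qed
        then show "\<exists>N. \<forall>n\<ge>N. B < norm ((f ^^ n) y)"
          by blast
      qed
    qed
    moreover have "frontier W \<noteq> {}"
      using z(1) W(3) not_bounded_UNIV by (intro frontier_not_empty) auto
    ultimately show False
      using fr by blast
  qed
qed

text \<open>The frontier of \<open>W\<close> may be disconnected, so \<open>W\<close> is filled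
  first. The connected frontier of the filling then lies in a single Fatou component, whose simple
  connectivity places the inside, and with it \<open>W\<close>, in the Fatou set.\<close>

lemma julia_meets_frontier:
  assumes sc: "\<forall>U\<in>components (fatou_set f). simply_connected U"
    and W: "open W" "connected W" "bounded W" "W \<inter> julia_set f \<noteq> {}"
  shows "frontier W \<inter> julia_set f \<noteq> {}"
proof
  assume "frontier W \<inter> julia_set f = {}"
  then have frW: "frontier W \<subseteq> fatou_set f"
    by (auto simp: julia_set_def)
  define D where "D = - outside W"
  note D = fill_bounded_domain[OF W(1-3), folded D_def]
  have WD: "W \<subseteq> D"
    unfolding D_def using outside_no_overlap[of W] by blast
  have "connected (frontier D)"
    using simply_connected_eq_frontier_properties[OF D(1)] D(3,4) by simp
  moreover have "frontier D \<subseteq> fatou_set f"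
    using D(5) frW by blast
  moreover have "frontier D \<noteq> {}"
    using WD W(4) D(3) not_bounded_UNIV by (intro frontier_not_empty) auto
  ultimately obtain V where V: "V \<in> components (fatou_set f)" "frontier D \<subseteq> V"
    using exists_component_superset[of "frontier D" "fatou_set f"] by blast
  have "inside (frontier D) \<subseteq> V"
    using sc V open_components[OF open_fatou_set V(1)]
    by (intro subset_simply_connected_imp_inside_subset) auto
  moreover have "D \<subseteq> inside (frontier D)"
    using interior_inside_frontier[OF D(3)] D(1) by (simp add: interior_open)
  ultimately have "W \<subseteq> fatou_set f"
    using WD in_components_subset[OF V(1)] by blast
  then show False
    using W(4) by (auto simp: julia_set_def)
qed

section \<open>The equivalences\<close>

lemma spiders_web_imp_separates:
  assumes "spiders_web E" "z \<in> julia_set f"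
  shows "\<exists>z\<in>julia_set f. separates_from_infinity E z"
proof -
  obtain G where G: "web_sequence E G"
    using assms(1) spiders_web_iff by blast
  then obtain n where "z \<in> G n"
    unfolding web_sequence_def by blast
  then have "separates_from_infinity E z"
    using G unfolding separates_from_infinity_def web_sequence_def by blast
  then show ?thesis
    using assms(2) by blast
qed

lemma spiders_web_nonempty:
  assumes "spiders_web E"
  shows "E \<noteq> {}"
proof -
  obtain G where G: "web_sequence E G"
    using assms spiders_web_iff by blast
  then obtain n where "0 \<in> G n"
    unfolding web_sequence_def by blast
  moreover have "bounded (G n)"
    using G by (simp add: web_sequence_def)
  ultimately have "frontier (G n) \<noteq> {}"
    using not_bounded_UNIV by (intro frontier_not_empty) auto
  then show ?thesis
    using G by (auto simp: web_sequence_def)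
qed

theorem theorem1p6:
  fixes f :: "complex \<Rightarrow> complex"
  assumes "transcendental_entire f"
  shows "(spiders_web (escaping_set f) \<longleftrightarrow>
            (\<exists>z\<in>julia_set f. separates_from_infinity (escaping_set f) z))
       \<and> (\<forall>R>0. filterlim (\<lambda>n. ((\<lambda>r. max_modulus r f) ^^ n) R) at_top sequentially \<longrightarrow>
            (spiders_web (fast_escaping_set f R) \<longleftrightarrow>
              (\<exists>z\<in>julia_set f. separates_from_infinity (fast_escaping_set f R) z)))
       \<and> ((\<forall>U\<in>components (fatou_set f). simply_connected U) \<longrightarrow>
            (spiders_web (julia_set f) \<longleftrightarrow>
              (\<exists>z\<in>julia_set f. separates_from_infinity (julia_set f) z)))"
proof (intro conjI allI impI)
  have hol: "f holomorphic_on UNIV"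
    using assms by (simp add: transcendental_entire_def)
  have sep: "\<exists>z\<in>julia_set f. separates_from_infinity E z"
    if "spiders_web E" "E \<subseteq> escaping_set f \<or> E = julia_set f" for E
  proof -
    have "julia_set f \<noteq> {}"
      using spiders_web_nonempty[OF that(1)] that(2) julia_set_nonempty[OF assms] by blast
    then show ?thesis
      using spiders_web_imp_separates[OF that(1)] by blast
  qed
  \<comment> \<open>The converse for all three sets. The condition \<open>meets\<close> may refer to
    the web already built, which the escaping set needs.\<close>
  have web: "spiders_web E"
    if E: "f ` E \<subseteq> E" "\<exists>z\<in>julia_set f. separates_from_infinity E z"
      and meets: "\<And>G W. web_sequence E G \<Longrightarrow> open W \<Longrightarrow> connected W \<Longrightarrow> bounded W \<Longrightarrow>
        W \<inter> E \<noteq> {} \<Longrightarrow> frontier W \<inter> E \<noteq> {}" for E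
  proof -
    obtain G where G: "web_sequence E G"
      using separates_imp_web_sequence[OF assms E(1)] E(2) by blast
    then have "connected E"
      using meets[OF G] by (rule web_sequence_imp_connected)
    then show ?thesis
      using G spiders_web_iff by blast
  qed
  show "spiders_web (escaping_set f) \<longleftrightarrow>
      (\<exists>z\<in>julia_set f. separates_from_infinity (escaping_set f) z)"
    using sep[of "escaping_set f"] web[OF escaping_set_forward] escaping_meets_frontier[OF assms]
    by blast
  show "spiders_web (fast_escaping_set f R) \<longleftrightarrow>
      (\<exists>z\<in>julia_set f. separates_from_infinity (fast_escaping_set f R) z)"
    if "R > 0" "filterlim (\<lambda>n. ((\<lambda>r. max_modulus r f) ^^ n) R) at_top sequentially" for R
    using sep[of "fast_escaping_set f R"] fast_escaping_subset_escaping[OF that(2)]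
      web[OF fast_escaping_set_forward[OF hol _ that(2)]] that(1)
      fast_escaping_meets_frontier[OF assms] by (meson less_imp_le)
  show "spiders_web (julia_set f) \<longleftrightarrow>
      (\<exists>z\<in>julia_set f. separates_from_infinity (julia_set f) z)"
    if "\<forall>U\<in>components (fatou_set f). simply_connected U"
    using sep[of "julia_set f"] web[OF julia_set_forward[OF hol]] julia_meets_frontier[OF that]
    by blast
qed

end
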